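(* For any $r\in(0,1)$ there are $s\in(0,1)$ and $N\in\mathbb{N}$ such that for every field $F$ and every finite subset $A\subseteq F$: if $\max(|A+A|,|AA|)\le |A|^{1+s}$ and $|A|\ge N$, then there is a subfield $E\subseteq F$ satisfying $|A|^{1-r}\le |E|\le |A|^{1+r}$. Moreover, one can require that $E=\frac{A'-A'}{A'-A'}$ for some $A'\subseteq A$ with $|A'|\ge |A|^{1-r}$.
   Context: For subsets $X,Y$ of a field, $X\pm Y=\{x\pm y:x\in X,y\in Y\}$, $XY=\{xy:x\in X,y\in Y\}$, and $\frac{X}{Y}=\{x/y:x\in X,\ y\in Y\setminus\{0\}\}$. *)

theory Defs
  imports "HOL-Algebra.Algebra" Complex_Main
begin

text \<open>
  Sum sets and product sets are the \<^const>\<open>set_add\<close> and \<^const>\<open>set_mult\<close> of the library;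
  the library has no counterpart for difference sets and quotient sets.
\<close>

definition diff_set :: "('a, 'm) ring_scheme \<Rightarrow> 'a set \<Rightarrow> 'a set \<Rightarrow> 'a set" where
  "diff_set F A B = {x \<ominus>\<^bsub>F\<^esub> y | x y. x \<in> A \<and> y \<in> B}"

definition quot_set :: "('a, 'm) ring_scheme \<Rightarrow> 'a set \<Rightarrow> 'a set \<Rightarrow> 'a set" where
  "quot_set F A B = {x \<otimes>\<^bsub>F\<^esub> inv\<^bsub>F\<^esub> y | x y. x \<in> A \<and> y \<in> B - {\<zero>\<^bsub>F\<^esub>}}"

text \<open>
  The conclusion \<open>finite E\<close> is part of the upper bound on the size of \<open>E\<close>, since
  \<^const>\<open>card\<close> is \<open>0\<close> on infinite sets.
\<close>

definition sum_product_subfield ::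
    "('a, 'm) ring_scheme \<Rightarrow> real \<Rightarrow> real \<Rightarrow> nat \<Rightarrow> bool" where
  "sum_product_subfield F r s N \<longleftrightarrow>
    (\<forall>A. A \<subseteq> carrier F \<longrightarrow> finite A \<longrightarrow> N \<le> card A \<longrightarrow>
       real (max (card (A <+>\<^bsub>F\<^esub> A)) (card (A <#>\<^bsub>F\<^esub> A))) \<le> real (card A) powr (1 + s) \<longrightarrow>
       (\<exists>E A'. subfield E F \<and> finite E \<and>
          real (card A) powr (1 - r) \<le> real (card E) \<and>
          real (card E) \<le> real (card A) powr (1 + r) \<and>
          A' \<subseteq> A \<and> real (card A) powr (1 - r) \<le> real (card A') \<and>
          E = quot_set F (diff_set F A' A') (diff_set F A' A')))"

text \<open>
  In ``there are \<open>s\<close> and \<open>N\<close> such that for every field'', the field may have any carrier type, whereas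
  a HOL formula cannot quantify over types below an existential quantifier. If \<open>s\<close> and \<open>N\<close> were
  obtained separately for each type, they could depend on it. The main theorem therefore consists of two
  parts: suitable \<open>s\<close> and \<open>N\<close> exist for all fields with carrier in \<^typ>\<open>nat\<close>, and any such
  \<open>s\<close> and \<open>N\<close> also serve for all fields with carrier in an arbitrary type. Together they say that one
  pair \<open>s\<close>, \<open>N\<close>, depending on \<open>r\<close> only, serves for all fields over all types.
\<close>

end

theory Submission
  imports Defs "HOL-Analysis.Convex" "HOL-Library.Countable_Set"
begin

text \<open>
  Let \<open>|A + A|, |AA| \<le> K |A|\<close> with \<open>K = |A|\<^sup>s\<close>. By Cauchy-Schwarz some \<open>b \<in> A\<close> has large
  \<open>aA \<inter> bA\<close> for all \<open>a\<close> in a large \<open>B \<subseteq> A\<close>. Since \<open>aA\<close> and \<open>bA\<close> have small doubling, Ruzsa's covering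
  lemma puts every such \<open>aA\<close> into \<open>O(K\<^sup>2)\<close> translates of \<open>b(A - A)\<close>, which by Petridis' form of the
  Pluennecke inequality is an approximate group. Hence \<open>|(c - d)B + (a - b)B| \<le> K\<^sup>O\<^sup>(\<^sup>1\<^sup>) |B|\<close> on \<open>B\<close>, that is
  \<open>|B + xB| \<le> K\<^sup>O\<^sup>(\<^sup>1\<^sup>) |B|\<close> for all \<open>x \<in> E = (B - B)/(B - B)\<close>. Conversely \<open>|B + xB| < |B|\<^sup>2\<close> forces
  \<open>x \<in> E\<close>. This gap makes \<open>E\<close> closed under sums and products, for then \<open>xB\<close> and \<open>yB\<close>, and so also
  \<open>(x + y)B\<close> and \<open>xyB\<close>, are covered by \<open>K\<^sup>O\<^sup>(\<^sup>1\<^sup>)\<close> translates of \<open>B - B\<close>.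

  The field generated by a finite set is countable, hence isomorphic to a field with carrier in
  \<^typ>\<open>nat\<close>; this gives the second part.
\<close>

no_notation Sum_Type.Plus (infixr \<open><+>\<close> 65)

section \<open>Additive combinatorics in abelian groups\<close>

lemma diff_setI: "x \<in> A \<Longrightarrow> y \<in> B \<Longrightarrow> x \<ominus>\<^bsub>G\<^esub> y \<in> diff_set G A B"
  unfolding diff_set_def by blast

lemma diff_setE:
  assumes "d \<in> diff_set G A B"
  obtains x y where "x \<in> A" "y \<in> B" "d = x \<ominus>\<^bsub>G\<^esub> y"
  using assms unfolding diff_set_def by blast

lemma diff_set_mono: "A \<subseteq> A' \<Longrightarrow> B \<subseteq> B' \<Longrightarrow> diff_set G A B \<subseteq> diff_set G A' B'"
  unfolding diff_set_def by blast

lemma finite_diff_set: "finite A \<Longrightarrow> finite B \<Longrightarrow> finite (diff_set G A B)"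
  unfolding diff_set_def by (rule finite_image_set2) auto

lemma set_addI: "x \<in> A \<Longrightarrow> y \<in> B \<Longrightarrow> x \<oplus>\<^bsub>G\<^esub> y \<in> A <+>\<^bsub>G\<^esub> B"
  unfolding set_add_def' by blast

lemma set_addE:
  assumes "d \<in> A <+>\<^bsub>G\<^esub> B"
  obtains x y where "x \<in> A" "y \<in> B" "d = x \<oplus>\<^bsub>G\<^esub> y"
  using assms unfolding set_add_def' by blast

lemma set_add_mono: "A \<subseteq> A' \<Longrightarrow> B \<subseteq> B' \<Longrightarrow> A <+>\<^bsub>G\<^esub> B \<subseteq> A' <+>\<^bsub>G\<^esub> B'"
  unfolding set_add_def' by blast

lemma set_add_eq_image: "A <+>\<^bsub>G\<^esub> B = (\<lambda>(x, y). x \<oplus>\<^bsub>G\<^esub> y) ` (A \<times> B)"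
  unfolding set_add_def' by auto

lemma finite_set_add: "finite A \<Longrightarrow> finite B \<Longrightarrow> finite (A <+>\<^bsub>G\<^esub> B)"
  unfolding set_add_eq_image by auto

lemma card_set_add_le: "finite A \<Longrightarrow> finite B \<Longrightarrow> card (A <+>\<^bsub>G\<^esub> B) \<le> card A * card B"
  unfolding set_add_eq_image by (metis card_cartesian_product card_image_le finite_SigmaI)

context abelian_group
begin

lemma add_minus_cancel_left:
  "\<lbrakk>x \<in> carrier G; y \<in> carrier G; z \<in> carrier G\<rbrakk> \<Longrightarrow> (x \<oplus> y) \<ominus> (x \<oplus> z) = y \<ominus> z"
  by (subst a_comm[of x y]) (simp_all add: minus_eq minus_add a_assoc r_neg2)

lemma add_minus_cancel_right:
  "\<lbrakk>x \<in> carrier G; y \<in> carrier G\<rbrakk> \<Longrightarrow> (x \<oplus> y) \<ominus> y = x"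
  by (simp add: minus_eq a_assoc r_neg)

lemma diff_set_closed: "A \<subseteq> carrier G \<Longrightarrow> B \<subseteq> carrier G \<Longrightarrow> diff_set G A B \<subseteq> carrier G"
  unfolding diff_set_def by auto

lemma set_add_assoc:
  assumes "A \<subseteq> carrier G" "B \<subseteq> carrier G" "C \<subseteq> carrier G"
  shows "(A <+> B) <+> C = A <+> (B <+> C)"
  using add.set_mult_assoc[OF assms] by (simp add: set_add_def)

lemma set_add_commute:
  assumes "A \<subseteq> carrier G" "B \<subseteq> carrier G"
  shows "A <+> B = B <+> A"
  using assms a_comm unfolding set_add_def' by blast

lemma card_translate:
  assumes "A \<subseteq> carrier G" "c \<in> carrier G"
  shows "card (A <+> {c}) = card A"
proof -
  have "A <+> {c} = (\<lambda>a. a \<oplus> c) ` A" unfolding set_add_def' by auto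
  moreover have "inj_on (\<lambda>a. a \<oplus> c) A" using assms by (auto simp: inj_on_def subset_iff)
  ultimately show ?thesis by (simp add: card_image)
qed

text \<open>Fix one representation \<open>d = y - z\<close> for each difference. The map sending
  \<open>(d, x)\<close> to \<open>(x + y, x + z)\<close> is injective: subtracting the coordinates
  recovers \<open>d\<close>, hence \<open>y\<close>, and then \<open>x\<close>.\<close>

lemma ruzsa_triangle:
  assumes "U \<subseteq> carrier G" "Y \<subseteq> carrier G" "Z \<subseteq> carrier G" "finite U" "finite Y" "finite Z"
  shows "card (diff_set G Y Z) * card U \<le> card (U <+> Y) * card (U <+> Z)"
proof -
  have "\<forall>d \<in> diff_set G Y Z. \<exists>p. fst p \<in> Y \<and> snd p \<in> Z \<and> d = fst p \<ominus> snd p"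
    by (auto elim!: diff_setE)
  then obtain p where p: "\<And>d. d \<in> diff_set G Y Z \<Longrightarrow>
      fst (p d) \<in> Y \<and> snd (p d) \<in> Z \<and> d = fst (p d) \<ominus> snd (p d)"
    by metis
  define f where "f = (\<lambda>(d, x). (x \<oplus> fst (p d), x \<oplus> snd (p d)))"
  have "inj_on f (diff_set G Y Z \<times> U)"
  proof (rule inj_onI, clarify)
    fix d x d' x'
    assume d: "d \<in> diff_set G Y Z" "d' \<in> diff_set G Y Z" and x: "x \<in> U" "x' \<in> U"
      and eq: "f (d, x) = f (d', x')"
    have c: "x \<in> carrier G" "x' \<in> carrier G" "fst (p d) \<in> carrier G" "snd (p d) \<in> carrier G"
      "fst (p d') \<in> carrier G" "snd (p d') \<in> carrier G"
      using d x p assms by blast+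
    have e: "x \<oplus> fst (p d) = x' \<oplus> fst (p d')" "x \<oplus> snd (p d) = x' \<oplus> snd (p d')"
      using eq by (auto simp: f_def)
    have "d = (x \<oplus> fst (p d)) \<ominus> (x \<oplus> snd (p d))"
      using p[OF d(1)] c by (simp add: add_minus_cancel_left)
    also have "\<dots> = (x' \<oplus> fst (p d')) \<ominus> (x' \<oplus> snd (p d'))"
      by (simp only: e)
    also have "\<dots> = d'"
      using p[OF d(2)] c by (simp add: add_minus_cancel_left)
    finally have "d = d'" .
    with e(1) c show "d = d' \<and> x = x'" by simp
  qed
  moreover have "f ` (diff_set G Y Z \<times> U) \<subseteq> (U <+> Y) \<times> (U <+> Z)"
    using p by (auto simp: f_def intro!: set_addI)
  moreover have "finite ((U <+> Y) \<times> (U <+> Z))"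
    using assms by (intro finite_cartesian_product finite_set_add)
  ultimately show ?thesis
    by (metis card_cartesian_product card_inj_on_le)
qed

text \<open>Petridis' argument: adding one more element \<open>c\<close> to \<open>C\<close> produces at most
  \<open>|U + A| - |Z + A|\<close> new elements of \<open>U + A + C\<close>, for a set \<open>Z\<close> that contains all \<open>x\<close>
  for which \<open>x + c\<close> is an old element of \<open>U + C\<close>.\<close>

lemma petridis:
  assumes U: "U \<subseteq> carrier G" "finite U" and A: "A \<subseteq> carrier G" "finite A"
    and C: "C \<subseteq> carrier G" "finite C"
    and min: "\<And>Z. Z \<subseteq> U \<Longrightarrow> card (U <+> A) * card Z \<le> card (Z <+> A) * card U"
  shows "card (U <+> A <+> C) * card U \<le> card (U <+> A) * card (U <+> C)"
  using C(2,1)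
proof (induction C rule: finite_induct)
  case empty
  then show ?case by (simp add: set_add_def')
next
  case (insert c C)
  then have c: "c \<in> carrier G" and C: "C \<subseteq> carrier G" by auto
  have UA: "U <+> A \<subseteq> carrier G" using U A by (simp add: set_add_closed)
  define Z where "Z = {x \<in> U. {x} <+> A <+> {c} \<subseteq> U <+> A <+> C}"
  define W where "W = {x \<in> U. x \<oplus> c \<in> U <+> C}"
  have Z: "Z \<subseteq> U" "finite Z" using U by (auto simp: Z_def)
  have W: "finite W" using U by (auto simp: W_def)
  have WZ: "W \<subseteq> Z"
  proof
    fix x assume "x \<in> W"
    then obtain x' c' where x': "x \<in> U" "x' \<in> U" "c' \<in> C" "x \<oplus> c = x' \<oplus> c'"
      by (auto simp: W_def elim: set_addE)
    have "x \<oplus> a \<oplus> c \<in> U <+> A <+> C" if "a \<in> A" for a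
    proof -
      have "x \<in> carrier G" "x' \<in> carrier G" "a \<in> carrier G" "c' \<in> carrier G"
        using x' that U A C by auto
      then have "x \<oplus> a \<oplus> c = (x \<oplus> c) \<oplus> a" "(x' \<oplus> c') \<oplus> a = x' \<oplus> a \<oplus> c'"
        using c by (simp_all add: a_ac)
      then have "x \<oplus> a \<oplus> c = x' \<oplus> a \<oplus> c'" using x'(4) by simp
      then show ?thesis using x' that by (simp add: set_addI)
    qed
    then show "x \<in> Z" using x' by (auto simp: Z_def elim!: set_addE)
  qed
  have new1: "U <+> A <+> insert c C \<subseteq> (U <+> A <+> C) \<union> ((U <+> A <+> {c}) - (Z <+> A <+> {c}))"
  proof
    fix v assume v: "v \<in> U <+> A <+> insert c C"
    show "v \<in> (U <+> A <+> C) \<union> ((U <+> A <+> {c}) - (Z <+> A <+> {c}))"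
    proof (cases "v \<in> U <+> A <+> C")
      case False
      have "v \<notin> Z <+> A <+> {c}"
      proof
        assume "v \<in> Z <+> A <+> {c}"
        then obtain z a where "z \<in> Z" "a \<in> A" "v = z \<oplus> a \<oplus> c" by (auto elim!: set_addE)
        then have "v \<in> {z} <+> A <+> {c}" by (auto intro: set_addI)
        with \<open>z \<in> Z\<close> False show False by (auto simp: Z_def)
      qed
      moreover have "v \<in> U <+> A <+> {c}"
        using v False by (auto elim!: set_addE intro: set_addI)
      ultimately show ?thesis by simp
    qed simp
  qed
  have Zc: "Z <+> A <+> {c} \<subseteq> U <+> A <+> {c}" using Z by (intro set_add_mono) auto
  have ZA: "Z <+> A \<subseteq> carrier G" using Z U A by (intro set_add_closed) auto
  have fin: "finite (U <+> A)" "finite (Z <+> A)" using U A Z by (auto intro: finite_set_add)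
  have "card (U <+> A <+> insert c C) \<le> card (U <+> A <+> C) + card ((U <+> A <+> {c}) - (Z <+> A <+> {c}))"
    by (rule order_trans[OF card_mono[OF _ new1] card_Un_le])
      (use fin insert.hyps in \<open>auto intro: finite_set_add\<close>)
  also have "card ((U <+> A <+> {c}) - (Z <+> A <+> {c})) = card (U <+> A) - card (Z <+> A)"
    using Zc fin card_translate[OF UA c] card_translate[OF ZA c]
    by (subst card_Diff_subset) (auto intro: finite_set_add)
  finally have b1: "card (U <+> A <+> insert c C) \<le> card (U <+> A <+> C) + (card (U <+> A) - card (Z <+> A))" .
  \<comment> \<open>For \<open>x\<close> in \<open>U\<close> outside \<open>W\<close> the element
    \<open>x + c\<close> is new, so passing from \<open>C\<close> to \<open>insert c C\<close>
    enlarges \<open>U + C\<close> by at least \<open>|U| - |W|\<close>.\<close>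
  have "(U <+> C) \<union> (\<lambda>x. x \<oplus> c) ` (U - W) \<subseteq> U <+> insert c C"
    by (auto elim!: set_addE intro: set_addI)
  moreover have "(U <+> C) \<inter> (\<lambda>x. x \<oplus> c) ` (U - W) = {}"
    by (auto simp: W_def)
  moreover have "card ((\<lambda>x. x \<oplus> c) ` (U - W)) = card U - card W"
    using U c W by (subst card_image) (auto simp: inj_on_def subset_iff W_def card_Diff_subset)
  ultimately have "card (U <+> C) + (card U - card W) \<le> card (U <+> insert c C)"
    using U insert.hyps
    by (metis card_Un_disjoint card_mono finite.insertI finite_Diff finite_imageI finite_set_add)
  moreover have "card W \<le> card Z" using WZ Z by (simp add: card_mono)
  ultimately have b2: "card (U <+> C) + (card U - card Z) \<le> card (U <+> insert c C)"
    by linarith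
  have zx: "card Z \<le> card U" using Z U by (simp add: card_mono)
  \<comment> \<open>Minimality applied to \<open>Z\<close> gives
    \<open>|U + A| |Z| \<le> |Z + A| |U|\<close>; so the increase on the left is at most
    \<open>|U + A|\<close> times the increase \<open>|U| - |Z|\<close> guaranteed on the
    right.\<close>
  have "card (U <+> A <+> insert c C) * card U
      \<le> card (U <+> A <+> C) * card U + (card (U <+> A) * card U - card (Z <+> A) * card U)"
    using mult_le_mono1[OF b1, of "card U"] by (simp add: add_mult_distrib diff_mult_distrib)
  also have "\<dots> \<le> card (U <+> A) * card (U <+> C) + (card (U <+> A) * card U - card (U <+> A) * card Z)"
    using insert.IH C min[OF Z(1)] by (intro add_mono diff_le_mono2) auto
  also have "\<dots> = card (U <+> A) * (card (U <+> C) + (card U - card Z))"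
    by (simp add: algebra_simps diff_mult_distrib2)
  also have "\<dots> \<le> card (U <+> A) * card (U <+> insert c C)"
    using b2 by simp
  finally show ?case .
qed

text \<open>\<open>U\<close> minimises the ratio \<open>|U + A| / |U|\<close> over nonempty subsets
  of \<open>A\<close>. The competitor \<open>A\<close> itself shows that the minimum is at most
  \<open>|A + A| / |A|\<close>, which may then replace it in Petridis' inequality.\<close>

lemma exists_petridis_set:
  assumes A: "A \<subseteq> carrier G" "finite A" "A \<noteq> {}"
  obtains U where "U \<subseteq> A" "U \<noteq> {}" "card (U <+> A) * card A \<le> card (A <+> A) * card U"
    "\<And>C. C \<subseteq> carrier G \<Longrightarrow> finite C \<Longrightarrow>
      card (U <+> A <+> C) * card A \<le> card (A <+> A) * card (U <+> C)"
proof -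
  define S where "S = Pow A - {{}}"
  define g where "g U = real (card (U <+> A)) / real (card U)" for U
  have S: "finite S" "S \<noteq> {}" using A by (auto simp: S_def)
  obtain U where U: "U \<in> S" "\<And>Z. Z \<in> S \<Longrightarrow> g U \<le> g Z"
    using S by (metis arg_min_if_finite(1) arg_min_least)
  have UA: "U \<subseteq> A" "U \<noteq> {}" and fX: "finite U" and X0: "card U > 0"
    using U(1) A by (auto simp: S_def finite_subset card_gt_0_iff)
  have A0: "card A > 0" using A by (simp add: card_gt_0_iff)
  have min: "card (U <+> A) * card Z \<le> card (Z <+> A) * card U" if "Z \<subseteq> A" for Z
  proof (cases "Z = {}")
    case False
    with that have "Z \<in> S" by (auto simp: S_def)
    moreover have "card Z > 0" using False that A by (meson card_gt_0_iff finite_subset)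
    ultimately have "real (card (U <+> A)) * card Z \<le> real (card (Z <+> A)) * card U"
      using U(2)[of Z] X0 by (simp add: g_def field_simps)
    then show ?thesis by (metis of_nat_le_iff of_nat_mult)
  qed simp
  show ?thesis
  proof
    show "U \<subseteq> A" "U \<noteq> {}" by fact+
    show m: "card (U <+> A) * card A \<le> card (A <+> A) * card U" using min[of A] by simp
    fix C assume C: "C \<subseteq> carrier G" "finite C"
    have "card (U <+> A <+> C) * card U \<le> card (U <+> A) * card (U <+> C)"
      using UA A C fX min by (intro petridis) auto
    then have "card (U <+> A <+> C) * card U * card A \<le> card (U <+> A) * card A * card (U <+> C)"
      using mult_le_mono1[of _ _ "card A"] by (simp add: ac_simps)
    also have "\<dots> \<le> card (A <+> A) * card U * card (U <+> C)"
      using m by simp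
    finally show "card (U <+> A <+> C) * card A \<le> card (A <+> A) * card (U <+> C)"
      using X0 by (simp add: ac_simps)
  qed
qed

text \<open>\<open>T\<close> is a maximal set of \<open>t\<close> in \<open>Y\<close> with pairwise
  disjoint translates \<open>t + U\<close>. These lie in \<open>Y + U\<close>, which bounds
  \<open>|T|\<close>. By maximality each \<open>y + U\<close> meets some \<open>t + U\<close>, so
  \<open>y\<close> lies in \<open>t + U - U\<close>.\<close>

lemma ruzsa_covering:
  assumes U: "U \<subseteq> carrier G" "finite U" "U \<noteq> {}" and Y: "Y \<subseteq> carrier G" "finite Y"
  obtains T where "T \<subseteq> Y" "card T * card U \<le> card (Y <+> U)" "Y \<subseteq> T <+> diff_set G U U"
proof -
  define S where "S = {T. T \<subseteq> Y \<and> (\<forall>t\<in>T. \<forall>u\<in>T. t \<noteq> u \<longrightarrow> ({t} <+> U) \<inter> ({u} <+> U) = {})}"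
  have "finite S" "S \<noteq> {}" using Y by (auto simp: S_def)
  then obtain T where T: "T \<in> S" "\<And>T'. T' \<in> S \<Longrightarrow> T \<subseteq> T' \<Longrightarrow> T = T'"
    by (meson finite_has_maximal)
  have TY: "T \<subseteq> Y" and fT: "finite T" using T(1) Y by (auto simp: S_def finite_subset)
  have "card T * card U = (\<Sum>t\<in>T. card ({t} <+> U))"
  proof -
    have "card ({t} <+> U) = card U" if "t \<in> T" for t
      using that TY U Y card_translate[of U t] set_add_commute[of "{t}" U] by auto
    then show ?thesis by simp
  qed
  also have "\<dots> = card (\<Union>t\<in>T. {t} <+> U)"
    using T(1) fT U by (subst card_UN_disjoint) (auto simp: S_def intro: finite_set_add)
  also have "\<dots> \<le> card (Y <+> U)"
    using TY U Y by (intro card_mono finite_set_add) (auto elim!: set_addE intro: set_addI)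
  finally have "card T * card U \<le> card (Y <+> U)" .
  moreover have "Y \<subseteq> T <+> diff_set G U U"
  proof
    fix y assume y: "y \<in> Y"
    show "y \<in> T <+> diff_set G U U"
    proof (cases "\<exists>t\<in>T. ({t} <+> U) \<inter> ({y} <+> U) \<noteq> {}")
      case True
      then obtain t x x' where t: "t \<in> T" "x \<in> U" "x' \<in> U" "t \<oplus> x = y \<oplus> x'"
        by (auto elim!: set_addE)
      have c: "t \<in> carrier G" "x \<in> carrier G" "x' \<in> carrier G" "y \<in> carrier G"
        using t y TY U Y by auto
      have "y = (y \<oplus> x') \<ominus> x'" using c by (simp add: add_minus_cancel_right)
      also have "\<dots> = t \<oplus> (x \<ominus> x')" unfolding t(4)[symmetric] using c by (simp add: minus_eq a_assoc)
      finally show ?thesis using t by (auto intro: set_addI diff_setI)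
    next
      case False
      then have "insert y T \<in> S" using T(1) y unfolding S_def by blast
      then have "y \<in> T" using T(2)[of "insert y T"] by auto
      obtain x where "x \<in> U" using U by auto
      then have "y = y \<oplus> (x \<ominus> x)" using U y Y by (simp add: minus_eq r_neg subset_iff)
      then show ?thesis using \<open>y \<in> T\<close> \<open>x \<in> U\<close> by (metis diff_setI set_addI)
    qed
  qed
  ultimately show ?thesis using that TY by blast
qed

end

section \<open>Approximate groups\<close>

text \<open>The bound \<open>M\<close> is real so that powers of a doubling constant can be inserted
  directly.\<close>

definition covered_by :: "('a, 'm) ring_scheme \<Rightarrow> real \<Rightarrow> 'a set \<Rightarrow> 'a set \<Rightarrow> bool" where
  "covered_by G M Y H \<longleftrightarrow>
    (\<exists>T. T \<subseteq> carrier G \<and> finite T \<and> real (card T) \<le> M \<and> Y \<subseteq> T <+>\<^bsub>G\<^esub> H)"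

text \<open>Finite symmetric sets with small doubling, the doubling being measured by coverings:
  unlike cardinalities, these compose and survive sums and dilations.\<close>

definition approximate_group :: "('a, 'm) ring_scheme \<Rightarrow> real \<Rightarrow> 'a set \<Rightarrow> bool" where
  "approximate_group G L H \<longleftrightarrow> H \<subseteq> carrier G \<and> finite H \<and> (\<forall>h\<in>H. \<ominus>\<^bsub>G\<^esub> h \<in> H) \<and>
    covered_by G L (H <+>\<^bsub>G\<^esub> H) H"

lemma covered_byI:
  "\<lbrakk>T \<subseteq> carrier G; finite T; real (card T) \<le> M; Y \<subseteq> T <+>\<^bsub>G\<^esub> H\<rbrakk> \<Longrightarrow> covered_by G M Y H"
  unfolding covered_by_def by blast

lemma covered_byE:
  assumes "covered_by G M Y H"
  obtains T where "T \<subseteq> carrier G" "finite T" "real (card T) \<le> M" "Y \<subseteq> T <+>\<^bsub>G\<^esub> H"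
  using assms unfolding covered_by_def by blast

lemma covered_by_mono:
  "\<lbrakk>covered_by G M Y H; Y' \<subseteq> Y; M \<le> M'\<rbrakk> \<Longrightarrow> covered_by G M' Y' H"
  by (elim covered_byE, rule covered_byI) auto

lemma covered_by_card_le:
  assumes "covered_by G M Y H" "finite H"
  shows "real (card Y) \<le> M * real (card H)"
proof -
  obtain T where T: "finite T" "real (card T) \<le> M" "Y \<subseteq> T <+>\<^bsub>G\<^esub> H"
    using assms(1) by (elim covered_byE)
  have "card Y \<le> card (T <+>\<^bsub>G\<^esub> H)" using T assms(2) by (intro card_mono finite_set_add) auto
  also have "\<dots> \<le> card T * card H" using T assms(2) by (intro card_set_add_le)
  finally have "real (card Y) \<le> real (card T) * real (card H)"
    by (metis of_nat_le_iff of_nat_mult)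
  also have "\<dots> \<le> M * real (card H)" using T(2) by (intro mult_right_mono) auto
  finally show ?thesis .
qed

context abelian_group
begin

section \<open>Calculus of coverings by translates\<close>

lemma covered_by_trans:
  assumes "covered_by G M Y H" "covered_by G N H H'" "H' \<subseteq> carrier G"
  shows "covered_by G (M * N) Y H'"
proof -
  obtain T where T: "T \<subseteq> carrier G" "finite T" "real (card T) \<le> M" "Y \<subseteq> T <+> H"
    using assms(1) by (elim covered_byE)
  obtain S where S: "S \<subseteq> carrier G" "finite S" "real (card S) \<le> N" "H \<subseteq> S <+> H'"
    using assms(2) by (elim covered_byE)
  have "Y \<subseteq> T <+> (S <+> H')" using T(4) set_add_mono[OF order_refl S(4), of G T] by simp
  then have "Y \<subseteq> (T <+> S) <+> H'" using T S assms by (simp add: set_add_assoc)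
  moreover have "real (card (T <+> S)) \<le> M * N"
  proof -
    have "real (card (T <+> S)) \<le> real (card T) * real (card S)"
      using card_set_add_le[OF T(2) S(2), of G] by (metis of_nat_le_iff of_nat_mult)
    also have "\<dots> \<le> M * N" using T S by (intro mult_mono) linarith+
    finally show ?thesis .
  qed
  ultimately show ?thesis
    using T S by (intro covered_byI[of "T <+> S"] finite_set_add) (auto simp: set_add_closed)
qed

lemma covered_by_set_add:
  assumes "covered_by G M Y H" "covered_by G N Y' H'" "H \<subseteq> carrier G" "H' \<subseteq> carrier G"
  shows "covered_by G (M * N) (Y <+> Y') (H <+> H')"
proof -
  obtain T where T: "T \<subseteq> carrier G" "finite T" "real (card T) \<le> M" "Y \<subseteq> T <+> H"
    using assms(1) by (elim covered_byE)
  obtain S where S: "S \<subseteq> carrier G" "finite S" "real (card S) \<le> N" "Y' \<subseteq> S <+> H'"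
    using assms(2) by (elim covered_byE)
  have "Y <+> Y' \<subseteq> (T <+> H) <+> (S <+> H')" using T S by (intro set_add_mono)
  also have "\<dots> \<subseteq> (T <+> S) <+> (H <+> H')"
  proof
    fix v assume "v \<in> (T <+> H) <+> (S <+> H')"
    then obtain t h s h' where v: "t \<in> T" "h \<in> H" "s \<in> S" "h' \<in> H'" "v = t \<oplus> h \<oplus> (s \<oplus> h')"
      by (auto elim!: set_addE)
    then have "v = t \<oplus> s \<oplus> (h \<oplus> h')" using T S assms by (simp add: a_ac subset_iff)
    then show "v \<in> (T <+> S) <+> (H <+> H')" using v by (auto intro!: set_addI)
  qed
  finally have "Y <+> Y' \<subseteq> (T <+> S) <+> (H <+> H')" .
  moreover have "real (card (T <+> S)) \<le> M * N"
  proof -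
    have "real (card (T <+> S)) \<le> real (card T) * real (card S)"
      using card_set_add_le[OF T(2) S(2), of G] by (metis of_nat_le_iff of_nat_mult)
    also have "\<dots> \<le> M * N" using T S by (intro mult_mono) linarith+
    finally show ?thesis .
  qed
  ultimately show ?thesis
    using T S by (intro covered_byI[of "T <+> S"] finite_set_add) (auto simp: set_add_closed)
qed

lemma covered_by_uminus:
  assumes "covered_by G M Y H" "H \<subseteq> carrier G" "\<And>h. h \<in> H \<Longrightarrow> \<ominus> h \<in> H"
  shows "covered_by G M ((\<lambda>y. \<ominus> y) ` Y) H"
proof -
  obtain T where T: "T \<subseteq> carrier G" "finite T" "real (card T) \<le> M" "Y \<subseteq> T <+> H"
    using assms(1) by (elim covered_byE)
  have "(\<lambda>y. \<ominus> y) ` Y \<subseteq> ((\<lambda>t. \<ominus> t) ` T) <+> H"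
  proof clarify
    fix y assume "y \<in> Y"
    then obtain t h where th: "t \<in> T" "h \<in> H" "y = t \<oplus> h" using T by (auto elim!: set_addE)
    then have "\<ominus> y = \<ominus> t \<oplus> \<ominus> h" using T assms by (simp add: minus_add subset_iff)
    then show "\<ominus> y \<in> ((\<lambda>t. \<ominus> t) ` T) <+> H" using th assms by (auto intro: set_addI)
  qed
  moreover have "real (card ((\<lambda>t. \<ominus> t) ` T)) \<le> M"
    using card_image_le[OF T(2), of "\<lambda>t. \<ominus> t"] T(3) by linarith
  ultimately show ?thesis using T by (intro covered_byI[of "(\<lambda>t. \<ominus> t) ` T"]) auto
qed

text \<open>The sum is covered by \<open>M * N\<close> translates of \<open>H + H\<close>, and each
  of them by \<open>L\<close> translates of \<open>H\<close>. Every addition thus costs one factor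
  \<open>L\<close>.\<close>

lemma approximate_group_covered_by_add:
  assumes "approximate_group G L H" "covered_by G M Y H" "covered_by G N Y' H"
  shows "covered_by G (M * N * L) (Y <+> Y') H"
  using assms covered_by_trans[OF covered_by_set_add[OF assms(2,3)]]
  unfolding approximate_group_def by blast

lemma diff_set_eq_set_add: "diff_set G A B = A <+> (\<lambda>y. \<ominus> y) ` B"
  unfolding diff_set_def set_add_def' minus_eq by blast

lemma approximate_group_covered_by_diff:
  assumes "approximate_group G L H" "covered_by G M Y H" "covered_by G N Y' H"
  shows "covered_by G (M * N * L) (diff_set G Y Y') H"
  unfolding diff_set_eq_set_add
  using assms approximate_group_covered_by_add[OF assms(1,2) covered_by_uminus[OF assms(3)]]
  unfolding approximate_group_def by blast

lemma uminus_diff_set: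
  assumes "A \<subseteq> carrier G" "h \<in> diff_set G A A"
  shows "\<ominus> h \<in> diff_set G A A"
proof -
  obtain x y where xy: "x \<in> A" "y \<in> A" "h = x \<ominus> y" using assms by (elim diff_setE)
  then have "\<ominus> h = y \<ominus> x"
    using assms by (simp add: minus_eq minus_add a_comm subset_iff)
  then show ?thesis using xy by (simp add: diff_setI)
qed

lemma covered_by_diff_set:
  assumes "A \<subseteq> carrier G" "A \<noteq> {}"
  shows "covered_by G 1 A (diff_set G A A)"
proof -
  obtain a where a: "a \<in> A" using assms by auto
  have "A \<subseteq> {a} <+> diff_set G A A"
  proof
    fix x assume x: "x \<in> A"
    have "a \<in> carrier G" "x \<in> carrier G" using assms a x by auto
    then have "x = a \<oplus> (x \<ominus> a)" by (simp add: minus_eq a_comm[of x] r_neg2)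
    then show "x \<in> {a} <+> diff_set G A A" using a x by (metis diff_setI set_addI singletonI)
  qed
  then show ?thesis using assms a by (intro covered_byI[of "{a}"]) auto
qed

text \<open>For a Petridis set \<open>U\<close> the sums \<open>U + A\<close>,
  \<open>U + 2A\<close>, \<open>U + 3A\<close> are small compared with \<open>U\<close>, and Ruzsa's
  triangle inequality converts this into bounds for \<open>A - A\<close> and \<open>3A - A\<close>.
  The latter lets \<open>A + A - A\<close> be covered by few translates of \<open>A - A\<close>, and
  two uses of this covering treat \<open>(A - A) + (A - A)\<close>.\<close>

lemma small_doubling:
  assumes A: "A \<subseteq> carrier G" "finite A" "A \<noteq> {}"
    and K: "real (card (A <+> A)) \<le> K * real (card A)"
  shows card_diff_set_le: "real (card (diff_set G A A)) \<le> K ^ 2 * real (card A)"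
    and approximate_group_diff_set: "approximate_group G (K ^ 8) (diff_set G A A)"
proof -
  obtain U where U: "U \<subseteq> A" "U \<noteq> {}"
    and U1: "card (U <+> A) * card A \<le> card (A <+> A) * card U"
    and U2: "\<And>C. C \<subseteq> carrier G \<Longrightarrow> finite C \<Longrightarrow>
      card (U <+> A <+> C) * card A \<le> card (A <+> A) * card (U <+> C)"
    using exists_petridis_set[OF A] by blast
  have fU: "finite U" and cU: "U \<subseteq> carrier G" using U A finite_subset by auto
  have n0: "real (card A) > 0" and u0: "real (card U) > 0"
    using A U fU by (simp_all add: card_gt_0_iff)
  have K0: "K \<ge> 0"
  proof -
    have "0 \<le> K * real (card A)" using K by linarith
    then show ?thesis using n0 by (simp add: zero_le_mult_iff)
  qed
  have cAA: "A <+> A \<subseteq> carrier G" and fAA: "finite (A <+> A)"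
    using A by (simp_all add: set_add_closed finite_set_add)
  have cA3: "A <+> (A <+> A) \<subseteq> carrier G" and fA3: "finite (A <+> (A <+> A))"
    using A cAA fAA by (simp_all add: set_add_closed finite_set_add)
  have step: "x \<le> K * y"
    if "x * real (card A) \<le> real (card (A <+> A)) * y" "y \<ge> 0" for x y
  proof -
    have "x * real (card A) \<le> K * real (card A) * y"
      using that mult_right_mono[OF K, of y] by linarith
    then show ?thesis using n0 by simp
  qed
  \<comment> \<open>The choice of \<open>U\<close> gives the first bound; Petridis' inequality with
    \<open>C = A\<close> and then \<open>C = A + A\<close> gives the next two, each further summand
    \<open>A\<close> costing a factor \<open>K\<close>.\<close>
  have k1: "real (card (U <+> A)) \<le> K * real (card U)"
    using U1 by (intro step) (simp_all flip: of_nat_mult)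
  have "real (card (U <+> A <+> A)) \<le> K * real (card (U <+> A))"
    using U2[of A] A by (intro step) (simp_all flip: of_nat_mult)
  also have "\<dots> \<le> K * (K * real (card U))" using k1 K0 by (intro mult_left_mono)
  finally have k2: "real (card (U <+> (A <+> A))) \<le> K ^ 2 * real (card U)"
    using cU A by (simp add: set_add_assoc power2_eq_square mult.assoc)
  have "real (card (U <+> A <+> (A <+> A))) \<le> K * real (card (U <+> (A <+> A)))"
    using U2[of "A <+> A"] cAA fAA by (intro step) (simp_all flip: of_nat_mult)
  also have "\<dots> \<le> K * (K ^ 2 * real (card U))" using k2 K0 by (intro mult_left_mono)
  finally have k3: "real (card (U <+> (A <+> (A <+> A)))) \<le> K ^ 3 * real (card U)"
    using cU A cAA by (simp add: set_add_assoc power2_eq_square power3_eq_cube mult.assoc)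
  \<comment> \<open>The triangle inequality through \<open>U\<close> trades the sums
    \<open>U + Y\<close> and \<open>U + A\<close> for the difference \<open>Y - A\<close>; finally
    \<open>|U| \<le> |A|\<close>.\<close>
  have triangle: "real (card (diff_set G Y A)) \<le> c * K * real (card A)"
    if Y: "Y \<subseteq> carrier G" "finite Y" and c: "real (card (U <+> Y)) \<le> c * real (card U)" for Y c
  proof -
    have c0: "c \<ge> 0"
    proof -
      have "0 \<le> c * real (card U)" using c by linarith
      then show ?thesis using u0 by (simp add: zero_le_mult_iff)
    qed
    have "real (card (diff_set G Y A)) * real (card U) \<le> real (card (U <+> Y)) * real (card (U <+> A))"
      using ruzsa_triangle[OF cU Y(1) A(1) fU Y(2) A(2)] by (simp flip: of_nat_mult)
    also have "\<dots> \<le> (c * real (card U)) * (K * real (card U))"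
      using c k1 c0 by (intro mult_mono) auto
    finally have "real (card (diff_set G Y A)) \<le> c * K * real (card U)"
      using u0 by simp
    also have "\<dots> \<le> c * K * real (card A)"
      using U A K0 c0 by (intro mult_left_mono) (auto intro: card_mono)
    finally show ?thesis .
  qed
  show "real (card (diff_set G A A)) \<le> K ^ 2 * real (card A)"
    using triangle[OF A(1,2) k1] by (simp add: power2_eq_square)
  define H where "H = diff_set G A A"
  have cH: "H \<subseteq> carrier G" and fH: "finite H"
    unfolding H_def using A by (simp_all add: diff_set_closed finite_diff_set)
  have H_uminus: "\<ominus> h \<in> H" if "h \<in> H" for h
    using that uminus_diff_set A unfolding H_def by blast
  \<comment> \<open>For \<open>Y = A + A - A\<close> the set \<open>Y + A\<close> lies in
    \<open>3A - A\<close>, so Ruzsa covering needs at most \<open>K^4\<close> translates of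
    \<open>H\<close> for \<open>Y\<close>.\<close>
  define Y where "Y = diff_set G (A <+> A) A"
  have cY: "Y \<subseteq> carrier G" and fY: "finite Y"
    unfolding Y_def using A cAA fAA by (simp_all add: diff_set_closed finite_diff_set)
  have "Y <+> A \<subseteq> diff_set G (A <+> (A <+> A)) A"
  proof
    fix v assume "v \<in> Y <+> A"
    then obtain a b c d where v: "a \<in> A" "b \<in> A" "c \<in> A" "d \<in> A" "v = ((a \<oplus> b) \<ominus> c) \<oplus> d"
      unfolding Y_def by (auto elim!: set_addE diff_setE)
    then have "v = (d \<oplus> (a \<oplus> b)) \<ominus> c" using A by (simp add: minus_eq a_ac subset_iff)
    then show "v \<in> diff_set G (A <+> (A <+> A)) A" using v by (auto intro!: set_addI diff_setI)
  qed
  then have "real (card (Y <+> A)) \<le> real (card (diff_set G (A <+> (A <+> A)) A))"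
    using fA3 A by (simp add: card_mono finite_diff_set)
  also have "\<dots> \<le> K ^ 3 * K * real (card A)" by (rule triangle[OF cA3 fA3 k3])
  finally have YA: "real (card (Y <+> A)) \<le> K ^ 4 * real (card A)"
    by (simp add: eval_nat_numeral)
  obtain T where T: "T \<subseteq> Y" "card T * card A \<le> card (Y <+> A)" "Y \<subseteq> T <+> H"
    using ruzsa_covering[OF A cY fY] unfolding H_def by blast
  have fT: "finite T" and cT: "T \<subseteq> carrier G" using T fY cY finite_subset by auto
  have "real (card T) * real (card A) \<le> K ^ 4 * real (card A)"
    using T(2) YA by (smt (verit) of_nat_le_iff of_nat_mult)
  then have T4: "real (card T) \<le> K ^ 4" using n0 by simp
  \<comment> \<open>Write \<open>a - b + c - d = (a + c - b) - d\<close>. Covering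
    \<open>a + c - b\<close> by \<open>t + (a' - b')\<close> leaves
    \<open>t - (b' + d - a')\<close>, whose bracket is again in \<open>Y\<close>; covering it by
    \<open>s + h\<close> leaves \<open>(t - s) - h\<close>.\<close>
  have "H <+> H \<subseteq> diff_set G T T <+> H"
  proof
    fix v assume "v \<in> H <+> H"
    then obtain a b c d where v: "a \<in> A" "b \<in> A" "c \<in> A" "d \<in> A" "v = (a \<ominus> b) \<oplus> (c \<ominus> d)"
      unfolding H_def by (auto elim!: set_addE diff_setE)
    have "(a \<oplus> c) \<ominus> b \<in> Y" unfolding Y_def using v by (auto intro!: set_addI diff_setI)
    then obtain t a' b' where t: "t \<in> T" "a' \<in> A" "b' \<in> A" "(a \<oplus> c) \<ominus> b = t \<oplus> (a' \<ominus> b')"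
      using T(3) unfolding H_def by (blast elim!: set_addE diff_setE)
    have "(b' \<oplus> d) \<ominus> a' \<in> Y" unfolding Y_def using v t by (auto intro!: set_addI diff_setI)
    then obtain s h where s: "s \<in> T" "h \<in> H" "(b' \<oplus> d) \<ominus> a' = s \<oplus> h"
      using T(3) by (blast elim!: set_addE)
    have c: "a \<in> carrier G" "b \<in> carrier G" "c \<in> carrier G" "d \<in> carrier G" "a' \<in> carrier G"
      "b' \<in> carrier G" "t \<in> carrier G" "s \<in> carrier G" "h \<in> carrier G"
      using v t s A cT cH by auto
    have "v = ((a \<oplus> c) \<ominus> b) \<ominus> d" unfolding v(5) using c by (simp add: minus_eq a_ac)
    also have "\<dots> = t \<ominus> ((b' \<oplus> d) \<ominus> a')" unfolding t(4) using c by (simp add: minus_eq minus_add a_ac)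
    also have "\<dots> = (t \<ominus> s) \<oplus> \<ominus> h" unfolding s(3) using c by (simp add: minus_eq minus_add a_ac)
    finally show "v \<in> diff_set G T T <+> H" using s t H_uminus by (auto intro: set_addI diff_setI)
  qed
  moreover have "real (card (diff_set G T T)) \<le> K ^ 8"
  proof -
    have "card (diff_set G T T) \<le> card T * card ((\<lambda>y. \<ominus> y) ` T)"
      unfolding diff_set_eq_set_add using fT by (intro card_set_add_le) auto
    also have "\<dots> \<le> card T * card T" using fT by (intro mult_left_mono card_image_le) auto
    finally have "real (card (diff_set G T T)) \<le> real (card T) * real (card T)"
      by (metis of_nat_le_iff of_nat_mult)
    also have "\<dots> \<le> K ^ 4 * K ^ 4" using T4 by (intro mult_mono) auto
    finally show ?thesis by (simp flip: power_add)
  qed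
  ultimately have "covered_by G (K ^ 8) (H <+> H) H"
    using cT fT by (intro covered_byI[of "diff_set G T T"]) (auto simp: diff_set_closed finite_diff_set)
  then show "approximate_group G (K ^ 8) (diff_set G A A)"
    using cH fH H_uminus unfolding approximate_group_def H_def by blast
qed

end

section \<open>Sets with small sum set and product set\<close>

text \<open>Cauchy-Schwarz for the function \<open>r\<close> counting how many of the sets contain
  \<open>v\<close>: its sum is the total size of the family, and its sum of squares counts the
  pairwise intersections.\<close>

lemma card_family_energy:
  assumes "finite I" "finite V" "\<And>i. i \<in> I \<Longrightarrow> S i \<subseteq> V"
  shows "(\<Sum>i\<in>I. real (card (S i)))\<^sup>2 \<le> real (card V) * (\<Sum>i\<in>I. \<Sum>j\<in>I. real (card (S i \<inter> S j)))"
proof -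
  define r where "r v = (\<Sum>i\<in>I. if v \<in> S i then 1 else (0::real))" for v
  have card_eq: "real (card W) = (\<Sum>v\<in>V. if v \<in> W then 1 else 0)" if "W \<subseteq> V" for W
    using that assms(2) by (simp add: sum.If_cases Int_absorb1)
  have "(\<Sum>i\<in>I. real (card (S i))) = (\<Sum>v\<in>V. r v)"
    unfolding r_def using assms by (subst sum.swap) (simp add: card_eq)
  moreover have "(\<Sum>i\<in>I. \<Sum>j\<in>I. real (card (S i \<inter> S j))) = (\<Sum>v\<in>V. (r v)\<^sup>2)"
  proof -
    have "(\<Sum>i\<in>I. \<Sum>j\<in>I. real (card (S i \<inter> S j)))
        = (\<Sum>i\<in>I. \<Sum>j\<in>I. \<Sum>v\<in>V. (if v \<in> S i then 1 else 0) * (if v \<in> S j then 1 else 0))"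
      using assms(3) by (intro sum.cong refl, subst card_eq) (auto intro!: sum.cong)
    also have "\<dots> = (\<Sum>i\<in>I. \<Sum>v\<in>V. \<Sum>j\<in>I. (if v \<in> S i then 1 else 0) * (if v \<in> S j then 1 else 0))"
      by (intro sum.cong refl sum.swap)
    also have "\<dots> = (\<Sum>v\<in>V. (r v)\<^sup>2)"
      unfolding r_def power2_eq_square sum_product by (rule sum.swap)
    finally show ?thesis .
  qed
  moreover have "(\<Sum>v\<in>V. r v)\<^sup>2 \<le> real (card V) * (\<Sum>v\<in>V. (r v)\<^sup>2)"
  proof (cases "V = {}")
    case False
    then show ?thesis using sum_squared_le_sum_of_squares[of r V] assms(2) by (simp add: mult.commute)
  qed simp
  ultimately show ?thesis by simp
qed

text \<open>The energy inequality for the singletons \<open>{f p}\<close>, which intersect exactly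
  at collisions of \<open>f\<close>.\<close>

lemma card_collisions:
  assumes "finite P" "finite V" "f ` P \<subseteq> V"
  shows "(real (card P))\<^sup>2 \<le> real (card V) * real (card {(p, q) \<in> P \<times> P. f p = f q})"
proof -
  have "(\<Sum>p\<in>P. \<Sum>q\<in>P. real (card ({f p} \<inter> {f q}))) = (\<Sum>x\<in>P \<times> P. if f (fst x) = f (snd x) then 1 else 0)"
    by (simp add: sum.cartesian_product split_def) (intro sum.cong, auto)
  also have "\<dots> = real (card {(p, q) \<in> P \<times> P. f p = f q})"
    using assms(1) by (simp add: sum.If_cases split_def Int_def mem_Times_iff conj_assoc)
  finally show ?thesis
    using card_family_energy[OF assms(1,2), of "\<lambda>p. {f p}"] assms(3) by auto
qed

context field
begin

section \<open>Dilates of sets, written as multiplicative cosets \<open>x <# Y\<close>\<close>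

lemma l_coset_eq_image: "x <# Y = (\<lambda>y. x \<otimes> y) ` Y"
  unfolding l_coset_def by auto

lemma l_coset_closed: "x \<in> carrier R \<Longrightarrow> Y \<subseteq> carrier R \<Longrightarrow> x <# Y \<subseteq> carrier R"
  unfolding l_coset_eq_image by auto

lemma finite_l_coset: "finite Y \<Longrightarrow> finite (x <# Y)"
  unfolding l_coset_eq_image by auto

lemma l_coset_mono: "Y \<subseteq> Z \<Longrightarrow> x <# Y \<subseteq> x <# Z"
  unfolding l_coset_eq_image by auto

lemma card_l_coset:
  assumes "x \<in> carrier R" "x \<noteq> \<zero>" "Y \<subseteq> carrier R"
  shows "card (x <# Y) = card Y"
  unfolding l_coset_eq_image using assms
  by (intro card_image) (auto simp: inj_on_def m_lcancel subset_iff)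

lemma l_coset_set_add:
  assumes "x \<in> carrier R" "Y \<subseteq> carrier R" "Z \<subseteq> carrier R"
  shows "x <# (Y <+> Z) = (x <# Y) <+> (x <# Z)"
proof -
  have "x \<otimes> (y \<oplus> z) = x \<otimes> y \<oplus> x \<otimes> z" if "y \<in> Y" "z \<in> Z" for y z
    using that assms by (simp add: r_distr subset_iff)
  then show ?thesis unfolding l_coset_def set_add_def' by simp
qed

lemma l_coset_diff_set:
  assumes "x \<in> carrier R" "Y \<subseteq> carrier R" "Z \<subseteq> carrier R"
  shows "x <# diff_set R Y Z = diff_set R (x <# Y) (x <# Z)"
proof -
  have *: "x \<otimes> (y \<ominus> z) = x \<otimes> y \<ominus> x \<otimes> z" if "y \<in> Y" "z \<in> Z" for y z
    using that assms by (simp add: minus_eq r_distr r_minus subset_iff)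
  show ?thesis
  proof
    show "x <# diff_set R Y Z \<subseteq> diff_set R (x <# Y) (x <# Z)"
      unfolding l_coset_eq_image by (auto elim!: diff_setE simp: * intro!: diff_setI)
    show "diff_set R (x <# Y) (x <# Z) \<subseteq> x <# diff_set R Y Z"
      unfolding l_coset_eq_image
      by (auto elim!: diff_setE simp: *[symmetric] intro!: diff_setI imageI)
  qed
qed

lemma l_coset_m_assoc:
  assumes "x \<in> carrier R" "y \<in> carrier R" "Z \<subseteq> carrier R"
  shows "(x \<otimes> y) <# Z = x <# (y <# Z)"
  unfolding l_coset_eq_image image_image using assms by (intro image_cong) (auto simp: m_assoc subset_iff)

lemma covered_by_l_coset:
  assumes "covered_by R M Y H" "x \<in> carrier R" "H \<subseteq> carrier R"
  shows "covered_by R M (x <# Y) (x <# H)"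
proof -
  obtain T where T: "T \<subseteq> carrier R" "finite T" "real (card T) \<le> M" "Y \<subseteq> T <+> H"
    using assms(1) by (elim covered_byE)
  have "x <# Y \<subseteq> x <# (T <+> H)" using T by (intro l_coset_mono)
  then have "x <# Y \<subseteq> (x <# T) <+> (x <# H)" using T assms by (simp add: l_coset_set_add)
  moreover have "card (x <# T) \<le> card T" unfolding l_coset_eq_image using T by (intro card_image_le)
  ultimately show ?thesis
    using T assms by (intro covered_byI[of "x <# T"]) (auto simp: l_coset_closed finite_l_coset)
qed

lemma approximate_group_l_coset:
  assumes "approximate_group R L H" "x \<in> carrier R"
  shows "approximate_group R L (x <# H)"
proof -
  have H: "H \<subseteq> carrier R" "finite H" "\<And>h. h \<in> H \<Longrightarrow> \<ominus> h \<in> H" "covered_by R L (H <+> H) H"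
    using assms unfolding approximate_group_def by auto
  have "covered_by R L ((x <# H) <+> (x <# H)) (x <# H)"
    using covered_by_l_coset[OF H(4) assms(2) H(1)] H assms by (simp add: l_coset_set_add)
  moreover have "\<ominus> (x \<otimes> h) \<in> x <# H" if "h \<in> H" for h
    using that H assms by (auto simp: l_coset_eq_image subset_iff simp flip: r_minus)
  ultimately show ?thesis
    using H assms unfolding approximate_group_def
    by (auto simp: l_coset_closed finite_l_coset) (auto simp: l_coset_eq_image)
qed

text \<open>The dilates \<open>aA\<close> for nonzero \<open>a\<close> in \<open>A\<close> have full
  size \<open>|A|\<close> but all lie in \<open>AA\<close>, of size at most \<open>K |A|\<close>. By
  the energy inequality some \<open>bA\<close> meets them in at least \<open>|A| / K\<close>
  elements on average, and many \<open>a\<close> reach half of this average.\<close>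

lemma card_set_mult_le_popular:
  assumes A: "A \<subseteq> carrier R" "finite A" "2 \<le> card A"
    and K: "1 \<le> K" "real (card (A <#> A)) \<le> K * real (card A)"
  obtains b B where "b \<in> A - {\<zero>}" "B \<subseteq> A - {\<zero>}" "real (card A) \<le> 4 * K * real (card B)"
    "\<And>a. a \<in> B \<Longrightarrow> real (card A) \<le> 2 * K * real (card ((a <# A) \<inter> (b <# A)))"
proof -
  define I where "I = A - {\<zero>}"
  define n where "n = real (card A)"
  define m where "m = real (card I)"
  define e where "e a b = real (card ((a <# A) \<inter> (b <# A)))" for a b
  have I: "I \<subseteq> A" "finite I" using A by (auto simp: I_def)
  \<comment> \<open>Removing zero costs at most one of at least two elements, hence at most half of
    \<open>A\<close>.\<close>
  have "card I \<ge> card A - 1" unfolding I_def by (simp add: card_Diff_singleton_if)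
  then have m: "2 * m \<ge> n" and n: "n \<ge> 2" using A(3) by (auto simp: m_def n_def)
  have m0: "m > 0" using m n by simp
  have cardI: "card (a <# A) = card A" if "a \<in> I" for a
    using that A by (intro card_l_coset) (auto simp: I_def)
  have AA: "finite (A <#> A)" unfolding set_mult_def using A by auto
  have "(\<Sum>a\<in>I. real (card (a <# A)))\<^sup>2 \<le> real (card (A <#> A)) * (\<Sum>a\<in>I. \<Sum>b\<in>I. e a b)"
    unfolding e_def using I AA by (intro card_family_energy) (auto simp: l_coset_def set_mult_def)
  also have "(\<Sum>a\<in>I. real (card (a <# A))) = m * n"
    using cardI by (simp add: m_def n_def)
  also have "real (card (A <#> A)) * (\<Sum>a\<in>I. \<Sum>b\<in>I. e a b) \<le> K * n * (\<Sum>a\<in>I. \<Sum>b\<in>I. e a b)"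
    using K unfolding n_def e_def by (intro mult_right_mono sum_nonneg) auto
  also have "(\<Sum>a\<in>I. \<Sum>b\<in>I. e a b) = (\<Sum>b\<in>I. \<Sum>a\<in>I. e a b)" by (rule sum.swap)
  finally have energy: "(m * n)\<^sup>2 \<le> K * n * (\<Sum>b\<in>I. \<Sum>a\<in>I. e a b)" .
  \<comment> \<open>If every \<open>b\<close> stayed below the average, summing over
    \<open>b\<close> would contradict the energy bound.\<close>
  have "\<exists>b\<in>I. m * n \<le> K * (\<Sum>a\<in>I. e a b)"
  proof (rule ccontr)
    assume "\<not> ?thesis"
    then have "(\<Sum>b\<in>I. K * (\<Sum>a\<in>I. e a b)) < (\<Sum>b\<in>I. m * n)"
      using I m0 by (intro sum_strict_mono) (auto simp: m_def)
    then have "K * (\<Sum>b\<in>I. \<Sum>a\<in>I. e a b) < m * (m * n)"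
      by (simp add: sum_distrib_left m_def)
    then have "K * (\<Sum>b\<in>I. \<Sum>a\<in>I. e a b) * n < m * (m * n) * n"
      using n by (intro mult_strict_right_mono) auto
    with energy show False by (simp add: power2_eq_square ac_simps)
  qed
  then obtain b where b: "b \<in> I" "m * n \<le> K * (\<Sum>a\<in>I. e a b)" by blast
  define B where "B = {a \<in> I. n \<le> 2 * K * e a b}"
  have B: "B \<subseteq> I" "finite B" using I by (auto simp: B_def)
  have "2 * (m * n) \<le> (\<Sum>a\<in>I. 2 * K * e a b)"
    using b(2) by (simp add: mult.assoc flip: sum_distrib_left)
  \<comment> \<open>Terms outside \<open>B\<close> are below the threshold \<open>n\<close>, and
    terms in \<open>B\<close> are at most \<open>2 * K * n\<close>, because no intersection exceeds
    \<open>n\<close>.\<close>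
  also have "\<dots> \<le> (\<Sum>a\<in>I. n + (if a \<in> B then 2 * K * n else 0))"
  proof (intro sum_mono)
    fix a assume a: "a \<in> I"
    have "card ((a <# A) \<inter> (b <# A)) \<le> card (a <# A)"
      using A by (intro card_mono finite_l_coset) auto
    then have "e a b \<le> n" using cardI[OF a] by (simp add: e_def n_def)
    then have "2 * K * e a b \<le> 2 * K * n" using K by (intro mult_left_mono) auto
    then show "2 * K * e a b \<le> n + (if a \<in> B then 2 * K * n else 0)"
      using a n by (auto simp: B_def)
  qed
  also have "\<dots> = m * n + real (card B) * (2 * K * n)"
    using I B by (simp add: sum.distrib sum.If_cases Int_absorb1 m_def)
  finally have "m * n \<le> 2 * K * real (card B) * n" by (simp add: algebra_simps)
  then have "m \<le> 2 * K * real (card B)" using n by (simp add: mult_le_cancel_right)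
  then have "n \<le> 4 * K * real (card B)" using m by simp
  then show ?thesis
    using b(1) B(1) by (intro that[of b B]) (simp_all add: I_def n_def B_def e_def)
qed

text \<open>For \<open>x = u / w\<close> with \<open>u\<close>, \<open>w\<close> in
  \<open>B - B\<close>, dilation by \<open>w\<close> turns \<open>B + xB\<close> into
  \<open>wB + uB\<close>. Both summands have short coverings by translates of the single approximate
  group \<open>H = b(A - A)\<close>, where \<open>b\<close> is the popular dilation.\<close>

lemma card_l_coset_sum_le:
  assumes A: "A \<subseteq> carrier R" "finite A" "2 \<le> card A"
    and K: "1 \<le> K" "real (card (A <#> A)) \<le> K * real (card A)"
      "real (card (A <+> A)) \<le> K * real (card A)"
  obtains B where "B \<subseteq> A" "real (card A) \<le> 4 * K * real (card B)"
    "\<And>x. x \<in> quot_set R (diff_set R B B) (diff_set R B B) \<Longrightarrow>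
      real (card (B <+> (x <# B))) \<le> 64 * K ^ 35 * real (card B)"
proof -
  obtain b B where b: "b \<in> A - {\<zero>}" and B: "B \<subseteq> A - {\<zero>}" "real (card A) \<le> 4 * K * real (card B)"
    and pop: "\<And>a. a \<in> B \<Longrightarrow> real (card A) \<le> 2 * K * real (card ((a <# A) \<inter> (b <# A)))"
    using card_set_mult_le_popular[OF A K(1,2)] by blast
  define n where "n = real (card A)"
  have n: "n \<ge> 2" using A by (simp add: n_def)
  have bc: "b \<in> carrier R" using b A by auto
  have cB: "B \<subseteq> carrier R" using B A by auto
  have A0: "A \<noteq> {}" using A by auto
  define H where "H = b <# diff_set R A A"
  have H: "approximate_group R (K ^ 8) H" and cardH: "real (card H) \<le> K ^ 2 * n"
  proof -
    show "approximate_group R (K ^ 8) H"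
      unfolding H_def using approximate_group_diff_set[OF A(1,2) A0 K(3)] bc
      by (rule approximate_group_l_coset)
    show "real (card H) \<le> K ^ 2 * n"
      using card_diff_set_le[OF A(1,2) A0 K(3)] b A
      unfolding H_def n_def by (subst card_l_coset) (auto simp: diff_set_closed)
  qed
  have cH: "H \<subseteq> carrier R" and fH: "finite H" using H by (auto simp: approximate_group_def)
  \<comment> \<open>\<open>J\<close> serves as a bridge: inside \<open>aA\<close> it makes
    \<open>aA + J\<close> as small as \<open>A + A\<close>, and inside \<open>bA\<close> it makes
    \<open>J - J\<close> a subset of \<open>H\<close>. Covering \<open>aA\<close> by translates of
    \<open>J - J\<close> costs \<open>K n / |J|\<close>, at most \<open>2 * K ^ 2\<close>.\<close>
  have cov: "covered_by R (2 * K ^ 2) (a <# A) H" if a: "a \<in> B" for a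
  proof -
    define J where "J = (a <# A) \<inter> (b <# A)"
    have ac: "a \<in> carrier R" "a \<noteq> \<zero>" using a B A by auto
    have aA: "a <# A \<subseteq> carrier R" "finite (a <# A)" using ac A by (auto simp: l_coset_closed finite_l_coset)
    have J: "J \<subseteq> carrier R" "finite J" using aA by (auto simp: J_def)
    have nJ: "n \<le> 2 * K * real (card J)" using pop[OF a] by (simp add: J_def n_def)
    then have "J \<noteq> {}" using n by auto
    then obtain T where T: "T \<subseteq> a <# A" "card T * card J \<le> card ((a <# A) <+> J)"
      "a <# A \<subseteq> T <+> diff_set R J J"
      using ruzsa_covering[OF J(1,2) _ aA] by blast
    have "card ((a <# A) <+> J) \<le> card ((a <# A) <+> (a <# A))"
      using aA by (intro card_mono finite_set_add set_add_mono) (auto simp: J_def)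
    also have "\<dots> = card (A <+> A)"
      using ac A by (simp add: card_l_coset set_add_closed flip: l_coset_set_add)
    finally have "real (card T) * real (card J) \<le> K * n"
      using T(2) K(3) unfolding n_def of_nat_mult[symmetric] by linarith
    also have "\<dots> \<le> K * (2 * K * real (card J))" using nJ K by (intro mult_left_mono) auto
    finally have "real (card T) * real (card J) \<le> (2 * K ^ 2) * real (card J)"
      by (simp add: power2_eq_square)
    moreover have "real (card J) > 0" using \<open>J \<noteq> {}\<close> J by (simp add: card_gt_0_iff)
    ultimately have "real (card T) \<le> 2 * K ^ 2" by simp
    moreover have "diff_set R J J \<subseteq> H"
      unfolding H_def using bc A by (simp add: l_coset_diff_set J_def diff_set_mono)
    then have "a <# A \<subseteq> T <+> H" using T(3) set_add_mono[OF order_refl] by blast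
    ultimately show ?thesis using T aA by (intro covered_byI[of T]) (auto intro: finite_subset)
  qed
  \<comment> \<open>\<open>(a - a')B\<close> lies in \<open>aA - a'A\<close>; two coverings with
    \<open>2 * K ^ 2\<close> translates each and one factor \<open>K ^ 8\<close> for the subtraction
    give \<open>4 * K ^ 12\<close>.\<close>
  have cov2: "covered_by R (4 * K ^ 12) ((a \<ominus> a') <# B) H" if a: "a \<in> B" "a' \<in> B" for a a'
  proof -
    have "covered_by R (2 * K ^ 2 * (2 * K ^ 2) * K ^ 8) (diff_set R (a <# A) (a' <# A)) H"
      using approximate_group_covered_by_diff[OF H cov[OF a(1)] cov[OF a(2)]] .
    moreover have "(a \<ominus> a') <# B \<subseteq> diff_set R (a <# A) (a' <# A)"
    proof
      fix v assume "v \<in> (a \<ominus> a') <# B"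
      then obtain y where y: "y \<in> B" "v = (a \<ominus> a') \<otimes> y" by (auto simp: l_coset_eq_image)
      then have "v = a \<otimes> y \<ominus> a' \<otimes> y" using a cB by (simp add: minus_eq l_distr l_minus subset_iff)
      then show "v \<in> diff_set R (a <# A) (a' <# A)"
        using y B by (auto simp: l_coset_eq_image intro!: diff_setI)
    qed
    ultimately show ?thesis by (elim covered_by_mono) (simp_all add: mult_ac flip: power_add)
  qed
  have "real (card (B <+> (x <# B))) \<le> 64 * K ^ 35 * real (card B)"
    if "x \<in> quot_set R (diff_set R B B) (diff_set R B B)" for x
  proof -
    obtain u w where uw: "u \<in> diff_set R B B" "w \<in> diff_set R B B" "w \<noteq> \<zero>" "x = u \<otimes> inv w"
      using \<open>x \<in> _\<close> unfolding quot_set_def by blast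
    have c: "u \<in> carrier R" "w \<in> carrier R" using uw cB diff_set_closed[OF cB cB] by auto
    then have wi: "inv w \<in> carrier R" "inv w \<otimes> w = \<one>" using uw by (simp_all add: field_Units)
    have xc: "x \<in> carrier R" using c wi uw by simp
    have "w \<otimes> x = u \<otimes> (inv w \<otimes> w)" unfolding uw(4) using c wi(1) by (simp add: m_ac)
    then have wx: "w \<otimes> x = u" using c wi by simp
    have "card (B <+> (x <# B)) = card (w <# (B <+> (x <# B)))"
      using c uw xc cB by (subst card_l_coset) (auto simp: set_add_closed l_coset_closed)
    also have "w <# (B <+> (x <# B)) = (w <# B) <+> (u <# B)"
      using c xc cB wx by (simp add: l_coset_set_add l_coset_closed flip: l_coset_m_assoc)
    finally have "real (card (B <+> (x <# B))) = real (card ((w <# B) <+> (u <# B)))" by simp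
    moreover have "covered_by R (4 * K ^ 12 * (4 * K ^ 12) * K ^ 8) ((w <# B) <+> (u <# B)) H"
      using uw(1,2) by (intro approximate_group_covered_by_add[OF H]) (auto elim!: diff_setE intro: cov2)
    then have "covered_by R (16 * K ^ 32) ((w <# B) <+> (u <# B)) H"
      by (elim covered_by_mono) (simp_all add: mult_ac flip: power_add)
    then have "real (card ((w <# B) <+> (u <# B))) \<le> 16 * K ^ 32 * real (card H)"
      using fH by (rule covered_by_card_le)
    \<comment> \<open>Back to \<open>|B|\<close> through \<open>|H| \<le> K^2 |A|\<close> and
      \<open>|A| \<le> 4 K |B|\<close>.\<close>
    also have "\<dots> \<le> 16 * K ^ 32 * (K ^ 2 * (4 * K * real (card B)))"
      using cardH B(2) K(1) unfolding n_def
      by (intro mult_left_mono order_trans[OF cardH[unfolded n_def]]) auto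
    also have "\<dots> = 64 * K ^ 35 * real (card B)" by (simp add: mult_ac flip: power_add power_Suc)
    finally show ?thesis by simp
  qed
  then show ?thesis using that[of B] B by blast
qed

end

section \<open>The quotient set of differences\<close>

context field
begin

section \<open>Collisions of \<open>a + x c\<close> and membership in the quotient set\<close>

lemma quot_diff_setI:
  "\<lbrakk>a \<in> B; b \<in> B; c \<in> B; d \<in> B; c \<ominus> d \<noteq> \<zero>\<rbrakk> \<Longrightarrow>
    (a \<ominus> b) \<otimes> inv (c \<ominus> d) \<in> quot_set R (diff_set R B B) (diff_set R B B)"
  unfolding quot_set_def by (blast intro: diff_setI)

text \<open>Serves two ends: a collision exhibits \<open>x\<close> as a quotient of differences, and
  it determines \<open>x\<close> uniquely.\<close>

lemma eq_quotient_of_collision: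
  assumes c: "a \<in> carrier R" "b \<in> carrier R" "c \<in> carrier R" "d \<in> carrier R" "x \<in> carrier R"
    and eq: "a \<oplus> x \<otimes> c = b \<oplus> x \<otimes> d" and ne: "c \<noteq> d"
  shows "x = (b \<ominus> a) \<otimes> inv (c \<ominus> d)"
proof -
  have w: "c \<ominus> d \<in> carrier R" "c \<ominus> d \<noteq> \<zero>" using c ne by simp_all
  then have wi: "inv (c \<ominus> d) \<in> carrier R" "(c \<ominus> d) \<otimes> inv (c \<ominus> d) = \<one>"
    by (simp_all add: field_Units)
  have "x \<otimes> (c \<ominus> d) = ((a \<oplus> x \<otimes> c) \<ominus> a) \<ominus> x \<otimes> d"
    using c by (simp add: minus_eq r_distr r_minus a_ac r_neg1 r_neg2)
  also have "\<dots> = b \<ominus> a" unfolding eq using c by (simp add: minus_eq a_ac r_neg r_neg1 r_neg2)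
  finally have "x \<otimes> (c \<ominus> d) \<otimes> inv (c \<ominus> d) = (b \<ominus> a) \<otimes> inv (c \<ominus> d)" by simp
  then have "(b \<ominus> a) \<otimes> inv (c \<ominus> d) = x \<otimes> ((c \<ominus> d) \<otimes> inv (c \<ominus> d))"
    using c(5) w(1) wi(1) by (simp only: m_assoc)
  then show ?thesis using wi c by simp
qed

text \<open>By pigeonhole the map \<open>(a, c)\<close> to \<open>a + x c\<close> on pairs from
  \<open>B\<close> has a collision. Its second coordinates differ, since equal ones would force
  equal first ones, so it displays \<open>x\<close> as a quotient.\<close>

lemma mem_quot_diff_set_of_card_less:
  assumes B: "B \<subseteq> carrier R" "finite B" and x: "x \<in> carrier R"
    and less: "card (B <+> (x <# B)) < card B * card B"
  shows "x \<in> quot_set R (diff_set R B B) (diff_set R B B)"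
proof -
  define f where "f = (\<lambda>(a, c). a \<oplus> x \<otimes> c)"
  have "f ` (B \<times> B) = B <+> (x <# B)"
    unfolding set_add_eq_image l_coset_eq_image f_def by force
  then have "\<not> inj_on f (B \<times> B)"
    using less card_image[of f "B \<times> B"] by (auto simp: card_cartesian_product)
  then obtain a b c d where s: "a \<in> B" "b \<in> B" "c \<in> B" "d \<in> B" "(a, c) \<noteq> (b, d)"
    "a \<oplus> x \<otimes> c = b \<oplus> x \<otimes> d"
    unfolding inj_on_def f_def by auto
  have cc: "a \<in> carrier R" "b \<in> carrier R" "c \<in> carrier R" "d \<in> carrier R" using s B by auto
  have "c \<noteq> d"
  proof
    assume "c = d"
    then have "a = b" using s(6) cc x by simp
    with s \<open>c = d\<close> show False by simp
  qed
  then show ?thesis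
    using eq_quotient_of_collision[OF cc x s(6)] quot_diff_setI[of b B a c d] s cc by simp
qed

lemma quot_diff_set_closed:
  assumes "B \<subseteq> carrier R"
  shows "quot_set R (diff_set R B B) (diff_set R B B) \<subseteq> carrier R"
  using diff_set_closed[OF assms assms] unfolding quot_set_def
  by (auto simp: field_Units subset_iff)

lemma finite_quot_set: "finite A \<Longrightarrow> finite B \<Longrightarrow> finite (quot_set R A B)"
  unfolding quot_set_def by (rule finite_image_set2) auto

text \<open>Counts the solutions of \<open>a + x c = b + x d\<close> with \<open>a, b, c, d \<in> B\<close> and \<open>x \<in> E\<close>:
  Cauchy-Schwarz gives many for each \<open>x\<close>, while a solution with \<open>c \<noteq> d\<close> determines \<open>x\<close>.\<close>

lemma card_le_of_card_l_coset_sum_le: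
  assumes B: "B \<subseteq> carrier R" "finite B" "B \<noteq> {}" and E: "E \<subseteq> carrier R" "finite E"
    and M: "\<And>x. x \<in> E \<Longrightarrow> real (card (B <+> (x <# B))) \<le> M * real (card B)"
    and large: "2 * M \<le> real (card B)" and M0: "0 \<le> M"
  shows "real (card E) \<le> 2 * M * real (card B)"
proof -
  define n where "n = real (card B)"
  have n0: "n > 0" using B by (simp add: n_def card_gt_0_iff)
  define P where "P = B \<times> B"
  define f where "f x = (\<lambda>(a, c). a \<oplus> x \<otimes> c)" for x
  have P: "finite P" "real (card P) = n ^ 2"
    using B by (simp_all add: P_def n_def card_cartesian_product power2_eq_square)
  define Q where "Q x = {(p, q) \<in> P \<times> P. f x p = f x q}" for x
  define Q' where "Q' x = {(p, q) \<in> P \<times> P. f x p = f x q \<and> snd p \<noteq> snd q}" for x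
  have fin: "finite (Q x)" "finite (Q' x)" for x
    using P unfolding Q_def Q'_def by (auto intro: finite_subset[of _ "P \<times> P"])
  have low: "n ^ 3 \<le> M * (n ^ 2 + real (card (Q' x)))" if x: "x \<in> E" for x
  proof -
    have xc: "x \<in> carrier R" using x E by auto
    \<comment> \<open>A collision with \<open>c = d\<close> has \<open>a = b\<close>, so apart from
      \<open>Q'\<close> there are only the \<open>n ^ 2\<close> diagonal ones.\<close>
    have "Q x \<subseteq> (\<lambda>p. (p, p)) ` P \<union> Q' x"
    proof
      fix z assume "z \<in> Q x"
      then obtain a c b d where z: "z = ((a, c), (b, d))" "a \<in> B" "b \<in> B" "c \<in> B" "d \<in> B"
        "a \<oplus> x \<otimes> c = b \<oplus> x \<otimes> d"
        unfolding Q_def P_def f_def by auto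
      show "z \<in> (\<lambda>p. (p, p)) ` P \<union> Q' x"
      proof (cases "c = d")
        case True
        then have "a = b" using z B xc by (auto simp: subset_iff)
        then show ?thesis using z True by (auto simp: P_def)
      next
        case False
        then show ?thesis using z by (auto simp: Q'_def P_def f_def)
      qed
    qed
    then have "card (Q x) \<le> card ((\<lambda>p. (p, p)) ` P \<union> Q' x)"
      using P fin by (intro card_mono) auto
    also have "\<dots> \<le> card P + card (Q' x)"
      using card_Un_le[of "(\<lambda>p. (p, p)) ` P" "Q' x"] card_image_le[OF P(1), of "\<lambda>p. (p, p)"] by linarith
    finally have q: "real (card (Q x)) \<le> n ^ 2 + real (card (Q' x))" using P by linarith
    have "f x ` P \<subseteq> B <+> (x <# B)"
      by (auto simp: f_def P_def l_coset_eq_image intro!: set_addI)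
    then have "(real (card P))\<^sup>2 \<le> real (card (B <+> (x <# B))) * real (card (Q x))"
      unfolding Q_def using B P by (intro card_collisions finite_set_add finite_l_coset)
    also have "\<dots> \<le> (M * n) * (n ^ 2 + real (card (Q' x)))"
      using M[OF x] q M0 n0 unfolding n_def[symmetric] by (intro mult_mono) auto
    finally have "n * n ^ 3 \<le> n * (M * (n ^ 2 + real (card (Q' x))))"
      unfolding P(2) by (simp add: eval_nat_numeral mult_ac)
    then show ?thesis using n0 by simp
  qed
  \<comment> \<open>A quadruple with \<open>c \<noteq> d\<close> belongs to one \<open>x\<close>
    only, so all the \<open>Q' x\<close> together have at most \<open>n ^ 4\<close>
    elements.\<close>
  have "(\<Sum>x\<in>E. card (Q' x)) = card (\<Union>x\<in>E. Q' x)"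
  proof (rule card_UN_disjoint[symmetric])
    show "\<forall>x\<in>E. \<forall>y\<in>E. x \<noteq> y \<longrightarrow> Q' x \<inter> Q' y = {}"
    proof (intro ballI impI)
      fix x y assume xy: "x \<in> E" "y \<in> E" "x \<noteq> y"
      show "Q' x \<inter> Q' y = {}"
      proof (rule ccontr)
        assume "Q' x \<inter> Q' y \<noteq> {}"
        then obtain a c b d where z: "a \<in> B" "b \<in> B" "c \<in> B" "d \<in> B" "c \<noteq> d"
          "a \<oplus> x \<otimes> c = b \<oplus> x \<otimes> d" "a \<oplus> y \<otimes> c = b \<oplus> y \<otimes> d"
          unfolding Q'_def P_def f_def by auto
        have "a \<in> carrier R" "b \<in> carrier R" "c \<in> carrier R" "d \<in> carrier R"
          "x \<in> carrier R" "y \<in> carrier R" using z B xy E by auto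
        then have "x = y"
          using eq_quotient_of_collision[of a b c d x] eq_quotient_of_collision[of a b c d y] z by simp
        with xy show False by simp
      qed
    qed
  qed (use E fin in auto)
  also have "\<dots> \<le> card (P \<times> P)" using P by (intro card_mono) (auto simp: Q'_def)
  finally have "real (\<Sum>x\<in>E. card (Q' x)) \<le> real (card (P \<times> P))" by (rule of_nat_mono)
  then have "(\<Sum>x\<in>E. real (card (Q' x))) \<le> n ^ 4"
    using P by (simp add: card_cartesian_product flip: power_add)
  then have "M * (\<Sum>x\<in>E. real (card (Q' x))) \<le> M * n ^ 4" using M0 by (rule mult_left_mono)
  moreover have "real (card E) * n ^ 3 \<le> (\<Sum>x\<in>E. M * (n ^ 2 + real (card (Q' x))))"
    using sum_mono[of E "\<lambda>_. n ^ 3", OF low] by simp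
  ultimately have "real (card E) * n ^ 3 \<le> real (card E) * (M * n ^ 2) + M * n ^ 4"
    by (simp add: sum.distrib distrib_left flip: sum_distrib_left)
  \<comment> \<open>Since \<open>2 * M \<le> n\<close>, the diagonal collisions account for at most
    half of the left side and can be absorbed.\<close>
  moreover have "2 * (real (card E) * (M * n ^ 2)) \<le> real (card E) * n ^ 3"
  proof -
    have "real (card E) * n ^ 2 * (2 * M) \<le> real (card E) * n ^ 2 * n"
      using large unfolding n_def by (intro mult_left_mono) auto
    then show ?thesis by (simp add: eval_nat_numeral mult_ac)
  qed
  ultimately have "n ^ 3 * real (card E) \<le> n ^ 3 * (2 * M * n)"
    by (simp add: eval_nat_numeral mult_ac)
  then show ?thesis using n0 unfolding n_def by simp
qed

text \<open>There is a gap: members satisfy \<open>|B + xB| \<le> M |B|\<close>, while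
  \<open>|B + xB| < |B|^2\<close> already implies membership. Coverings of \<open>(x + y)B\<close>
  and \<open>xyB\<close> by translates of \<open>D = B - B\<close> stay within the gap; negatives
  and inverses can be read off from the quotient form.\<close>

lemma subfield_quot_diff_set:
  assumes B: "B \<subseteq> carrier R" "finite B"
    and E: "E = quot_set R (diff_set R B B) (diff_set R B B)"
    and L: "1 \<le> L" "real (card (B <+> B)) \<le> L * real (card B)"
    and M: "1 \<le> M" "\<And>x. x \<in> E \<Longrightarrow> real (card (B <+> (x <# B))) \<le> M * real (card B)"
    and large: "M ^ 3 * L ^ 18 < real (card B)"
  shows "subfield E R"
proof -
  define D where "D = diff_set R B B"
  have "1 \<le> M ^ 3 * L ^ 18" using L(1) M(1) mult_mono[of 1 "M ^ 3" 1 "L ^ 18"] by simp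
  then have b1: "real (card B) > 1" using large by linarith
  then have B0: "B \<noteq> {}" by auto
  have D: "approximate_group R (L ^ 8) D" and cardD: "real (card D) \<le> L ^ 2 * real (card B)"
    unfolding D_def using approximate_group_diff_set[OF B B0 L(2)] card_diff_set_le[OF B B0 L(2)] .
  have cD: "D \<subseteq> carrier R" and fD: "finite D"
    unfolding D_def using B by (simp_all add: diff_set_closed finite_diff_set)
  have cE: "E \<subseteq> carrier R" unfolding E using B by (intro quot_diff_set_closed)
  have cov: "covered_by R M (x <# B) D" if x: "x \<in> E" for x
  proof -
    have xB: "x <# B \<subseteq> carrier R" "finite (x <# B)"
      using x cE B l_coset_closed[of x B] by (auto simp: finite_l_coset)
    obtain T where T: "T \<subseteq> x <# B" "card T * card B \<le> card ((x <# B) <+> B)" "x <# B \<subseteq> T <+> D"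
      using ruzsa_covering[OF B B0 xB] unfolding D_def by blast
    have "real (card T) * real (card B) \<le> M * real (card B)"
      using T(2) M(2)[OF x] set_add_commute[OF xB(1) B(1)]
      by (metis of_nat_le_iff of_nat_mult order_trans)
    then have "real (card T) \<le> M" using b1 by simp
    then show ?thesis using T xB by (intro covered_byI[of T]) (auto intro: finite_subset)
  qed
  \<comment> \<open>\<open>B\<close> lies in one translate of \<open>D\<close>, adding it to
    \<open>xB\<close> costs \<open>L ^ 8\<close>, and \<open>|D| \<le> L^2 |B|\<close>. In total
    \<open>M ^ 3 * L ^ 18\<close>, which \<open>large\<close> keeps below
    \<open>|B|\<close>.\<close>
  have mem: "x \<in> E" if x: "x \<in> carrier R" "covered_by R (M ^ 3 * L ^ 8) (x <# B) D" for x
  proof -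
    have "covered_by R (1 * (M ^ 3 * L ^ 8) * L ^ 8) (B <+> (x <# B)) D"
      using x covered_by_diff_set[OF B(1) B0] unfolding D_def[symmetric]
      by (intro approximate_group_covered_by_add[OF D])
    then have "real (card (B <+> (x <# B))) \<le> 1 * (M ^ 3 * L ^ 8) * L ^ 8 * real (card D)"
      using fD by (rule covered_by_card_le)
    also have "\<dots> \<le> 1 * (M ^ 3 * L ^ 8) * L ^ 8 * (L ^ 2 * real (card B))"
      using cardD L M by (intro mult_left_mono) auto
    also have "\<dots> = M ^ 3 * L ^ 18 * real (card B)" by (simp add: mult_ac flip: power_add)
    also have "\<dots> < real (card B) * real (card B)" using large b1 by (intro mult_strict_right_mono) auto
    finally have "card (B <+> (x <# B)) < card B * card B"
      by (metis of_nat_less_iff of_nat_mult)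
    then show ?thesis unfolding E using B x(1) by (intro mem_quot_diff_set_of_card_less)
  qed
  have repr: "\<exists>u w. u \<in> D \<and> w \<in> D \<and> w \<noteq> \<zero> \<and> x = u \<otimes> inv w" if "x \<in> E" for x
    using that unfolding E quot_set_def D_def by blast
  have inE: "u \<otimes> inv w \<in> E" if "u \<in> D" "w \<in> D" "w \<noteq> \<zero>" for u w
    using that unfolding E quot_set_def D_def by blast
  have "\<not> card B \<le> Suc 0" using b1 by simp
  then obtain a b where ab: "a \<in> B" "b \<in> B" "a \<noteq> b"
    using card_le_Suc0_iff_eq[OF B(2)] by blast
  then have c: "a \<in> carrier R" "b \<in> carrier R" using B by auto
  show ?thesis
  proof (intro subfieldI' subringI)
    show "E \<subseteq> carrier R" by fact
    have "a \<ominus> b \<noteq> \<zero>" "a \<ominus> b \<in> carrier R" using ab c by simp_all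
    then have "(a \<ominus> b) \<otimes> inv (a \<ominus> b) = \<one>" by (simp add: field_Units)
    then show "\<one> \<in> E" using inE[of "a \<ominus> b" "a \<ominus> b"] ab \<open>a \<ominus> b \<noteq> \<zero>\<close>
      by (simp add: D_def diff_setI)
  next
    fix x assume x: "x \<in> E"
    then obtain u w where uw: "u \<in> D" "w \<in> D" "w \<noteq> \<zero>" "x = u \<otimes> inv w" using repr by blast
    have "inv w \<in> carrier R" using uw cD by (auto simp: field_Units)
    then have "\<ominus> x = (\<ominus> u) \<otimes> inv w" using uw cD by (auto simp: l_minus)
    moreover have "\<ominus> u \<in> D" using D uw by (auto simp: approximate_group_def)
    ultimately show "\<ominus> x \<in> E" using uw inE by simp
  next
    fix x y assume xy: "x \<in> E" "y \<in> E"
    have c: "x \<in> carrier R" "y \<in> carrier R" using xy cE by auto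
    have "(x \<oplus> y) <# B \<subseteq> (x <# B) <+> (y <# B)"
      using c B by (auto simp: l_coset_eq_image l_distr subset_iff intro!: set_addI)
    moreover have "M * M * L ^ 8 \<le> M ^ 3 * L ^ 8"
      using M L power_increasing[of 2 3 M] by (simp add: power2_eq_square)
    ultimately have "covered_by R (M ^ 3 * L ^ 8) ((x \<oplus> y) <# B) D"
      using covered_by_mono[OF approximate_group_covered_by_add[OF D cov[OF xy(1)] cov[OF xy(2)]]]
      by blast
    then show "x \<oplus> y \<in> E" using c by (intro mem) auto
    \<comment> \<open>Dilating the covering of \<open>yB\<close> by \<open>x\<close> covers
      \<open>xyB\<close> by translates of \<open>xD\<close>, and \<open>xD = xB - xB\<close> is
      covered by \<open>M * M * L ^ 8\<close> translates of \<open>D\<close>. This yields the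
      exponent 3 of \<open>M\<close>.\<close>
    have "covered_by R M (x <# (y <# B)) (x <# D)"
      using cov[OF xy(2)] c cD by (intro covered_by_l_coset)
    moreover have "covered_by R (M * M * L ^ 8) (x <# D) D"
      using approximate_group_covered_by_diff[OF D cov[OF xy(1)] cov[OF xy(1)]] c B
      unfolding D_def by (simp add: l_coset_diff_set)
    ultimately have "covered_by R (M * (M * M * L ^ 8)) (x <# (y <# B)) D"
      using cD by (rule covered_by_trans)
    then have "covered_by R (M ^ 3 * L ^ 8) ((x \<otimes> y) <# B) D"
      using c B by (simp add: l_coset_m_assoc power3_eq_cube mult.assoc)
    then show "x \<otimes> y \<in> E" using c by (intro mem) auto
  next
    fix x assume x: "x \<in> E - {\<zero>}"
    then obtain u w where uw: "u \<in> D" "w \<in> D" "w \<noteq> \<zero>" "x = u \<otimes> inv w" using repr by blast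
    have c: "u \<in> carrier R" "w \<in> carrier R" "x \<in> carrier R" using uw cD x cE by auto
    have wi: "inv w \<in> carrier R" "w \<otimes> inv w = \<one>" using uw c by (simp_all add: field_Units)
    have u0: "u \<noteq> \<zero>" using x uw wi by auto
    then have ui: "inv u \<in> carrier R" "u \<otimes> inv u = \<one>" using c by (simp_all add: field_Units)
    have "x \<otimes> (w \<otimes> inv u) = (w \<otimes> inv w) \<otimes> (u \<otimes> inv u)"
      unfolding uw(4) using c(1,2) wi(1) ui(1) by (simp add: m_ac)
    then have "x \<otimes> (w \<otimes> inv u) = \<one>" using wi ui by simp
    then have "inv x = w \<otimes> inv u" using c ui by (intro comm_inv_char) auto
    then show "inv x \<in> E" using inE[of w u] uw u0 by simp
  qed
qed

text \<open>For fixed distinct \<open>a\<close>, \<open>b\<close> in \<open>B\<close>, the affine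
  map sending \<open>x\<close> to \<open>(x - b) / (a - b)\<close> embeds \<open>B\<close> into the
  quotient set.\<close>

lemma card_le_card_quot_diff_set:
  assumes B: "B \<subseteq> carrier R" "finite B" "2 \<le> card B"
  shows "card B \<le> card (quot_set R (diff_set R B B) (diff_set R B B))"
proof -
  have "\<not> card B \<le> Suc 0" using B(3) by simp
  then obtain a b where ab: "a \<in> B" "b \<in> B" "a \<noteq> b"
    using card_le_Suc0_iff_eq[OF B(2)] by blast
  have c: "a \<in> carrier R" "b \<in> carrier R" using ab B by auto
  have w: "a \<ominus> b \<noteq> \<zero>" "a \<ominus> b \<in> carrier R" using ab c by simp_all
  have wi: "inv (a \<ominus> b) \<in> carrier R" "inv (a \<ominus> b) \<noteq> \<zero>"
    using w Units_inv_Units[of "a \<ominus> b"] by (simp_all add: field_Units)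
  have "inj_on (\<lambda>x. (x \<ominus> b) \<otimes> inv (a \<ominus> b)) B"
  proof (rule inj_onI)
    fix x y assume xy: "x \<in> B" "y \<in> B" "(x \<ominus> b) \<otimes> inv (a \<ominus> b) = (y \<ominus> b) \<otimes> inv (a \<ominus> b)"
    have xyc: "x \<in> carrier R" "y \<in> carrier R" using xy B by auto
    then have "x \<ominus> b = y \<ominus> b" using xy(3) wi c by (simp add: m_rcancel)
    then show "x = y" using xyc c by (simp add: minus_eq)
  qed
  then show ?thesis
    using ab w B by (elim card_inj_on_le) (auto intro: quot_diff_setI finite_quot_set finite_diff_set)
qed

text \<open>Assembles the bounds. As \<open>K\<close> is at least 4, the constants 4, 64 and 2 are
  absorbed into \<open>K\<close>, \<open>K ^ 3\<close> and \<open>K\<close>.\<close>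

lemma exists_subfield_of_small_sum_product:
  assumes A: "A \<subseteq> carrier R" "finite A"
    and K: "4 \<le> K" "real (card (A <#> A)) \<le> K * real (card A)"
      "real (card (A <+> A)) \<le> K * real (card A)"
    and large: "K ^ 171 \<le> real (card A)"
  obtains B E where "B \<subseteq> A" "E = quot_set R (diff_set R B B) (diff_set R B B)" "subfield E R"
    "finite E" "real (card A) \<le> K ^ 2 * real (card B)" "card B \<le> card E"
    "real (card E) \<le> K ^ 39 * real (card A)"
proof -
  have K1: "1 \<le> K" using K by simp
  have pow4: "4 ^ k \<le> K ^ k" for k using K by (intro power_mono) auto
  have "K ^ 1 \<le> K ^ 171" using K1 by (intro power_increasing) auto
  then have "2 \<le> real (card A)" using K(1) large by simp
  then have "2 \<le> card A" by simp
  then obtain B where B: "B \<subseteq> A" "real (card A) \<le> 4 * K * real (card B)"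
    and M: "\<And>x. x \<in> quot_set R (diff_set R B B) (diff_set R B B) \<Longrightarrow>
      real (card (B <+> (x <# B))) \<le> 64 * K ^ 35 * real (card B)"
    using card_l_coset_sum_le[OF A _ K1 K(2,3)] by blast
  define E where "E = quot_set R (diff_set R B B) (diff_set R B B)"
  have cB: "B \<subseteq> carrier R" and fB: "finite B" using B A by (auto intro: finite_subset)
  have AB: "real (card A) \<le> K ^ 2 * real (card B)"
  proof -
    have "4 * K * real (card B) \<le> K * K * real (card B)"
      using K(1) by (intro mult_right_mono) auto
    then show ?thesis using B(2) by (simp add: power2_eq_square)
  qed
  \<comment> \<open>Cancel \<open>K ^ 2\<close> in
    \<open>K^171 \<le> |A| \<le> K^2 |B|\<close>.\<close>
  have nB: "K ^ 169 \<le> real (card B)"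
  proof (rule mult_left_le_imp_le)
    show "K ^ 2 * K ^ 169 \<le> K ^ 2 * real (card B)" using large AB by (simp flip: power_add)
  qed (use K1 in simp)
  have "real (card (B <+> B)) \<le> real (card (A <+> A))"
    using B A by (simp add: card_mono finite_set_add set_add_mono)
  also have "\<dots> \<le> K * (K ^ 2 * real (card B))"
    using K(3) mult_left_mono[OF AB, of K] K1 by linarith
  finally have BB: "real (card (B <+> B)) \<le> K ^ 3 * real (card B)"
    by (simp add: eval_nat_numeral)
  have M': "real (card (B <+> (x <# B))) \<le> K ^ 38 * real (card B)" if "x \<in> E" for x
  proof -
    have "64 * K ^ 35 * real (card B) \<le> K ^ 3 * K ^ 35 * real (card B)"
      using pow4[of 3] K1 by (intro mult_right_mono) auto
    then show ?thesis using M[of x] that by (simp add: E_def flip: power_add)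
  qed
  \<comment> \<open>The size condition of the subfield criterion for \<open>M = K ^ 38\<close> and
    \<open>L = K ^ 3\<close>.\<close>
  have "(K ^ 38) ^ 3 * (K ^ 3) ^ 18 = K ^ 168" by (simp flip: power_mult power_add)
  also have "\<dots> < K ^ 169" using K(1) by (intro power_strict_increasing) auto
  finally have "(K ^ 38) ^ 3 * (K ^ 3) ^ 18 < real (card B)" using nB by linarith
  then have sub: "subfield E R"
    using K1 BB M' by (intro subfield_quot_diff_set[OF cB fB E_def, of "K ^ 3" "K ^ 38"]) auto
  have fE: "finite E" unfolding E_def using fB by (intro finite_quot_set finite_diff_set)
  have "K ^ 1 \<le> K ^ 169" using K1 by (intro power_increasing) auto
  then have "2 \<le> real (card B)" using K(1) nB by simp
  then have B2: "2 \<le> card B" by simp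
  have "2 * K ^ 38 \<le> K * K ^ 38" using K by (intro mult_right_mono) auto
  also have "\<dots> = K ^ 39" using power_add[of K 1 38] by simp
  finally have K39: "2 * K ^ 38 \<le> K ^ 39" .
  also have "\<dots> \<le> K ^ 169" using K1 by (intro power_increasing) auto
  finally have "2 * K ^ 38 \<le> real (card B)" using nB by linarith
  then have "real (card E) \<le> 2 * K ^ 38 * real (card B)"
    using K1 M' sub B2 cB fB fE
    by (intro card_le_of_card_l_coset_sum_le) (auto simp: E_def quot_diff_set_closed)
  also have "\<dots> \<le> K ^ 39 * real (card A)"
    using K39 K1 B A by (intro mult_mono) (auto intro: card_mono)
  finally have "real (card E) \<le> K ^ 39 * real (card A)" .
  moreover have "card B \<le> card E" unfolding E_def using cB fB B2 by (rule card_le_card_quot_diff_set)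
  ultimately show ?thesis using that[of B E] B sub fE AB unfolding E_def by blast
qed

text \<open>With \<open>K = |A|^s\<close> the requirements are \<open>171 * s \<le> 1\<close> for
  the size of \<open>A\<close>, \<open>2 * s \<le> r\<close> for that of \<open>B\<close> and
  \<open>39 * s \<le> r\<close> for that of \<open>E\<close>; all hold for
  \<open>s = r / 200\<close>. The condition on \<open>N\<close> says that \<open>K\<close> is at
  least 4.\<close>

lemma sum_product_subfield_explicit:
  assumes r: "0 < r" "r < 1" and s: "s = r / 200" and N: "4 powr (1 / s) \<le> real N"
  shows "sum_product_subfield R r s N"
  unfolding sum_product_subfield_def
proof (intro allI impI)
  fix A assume A: "A \<subseteq> carrier R" "finite A" and NA: "N \<le> card A"
    and small: "real (max (card (A <+> A)) (card (A <#> A))) \<le> real (card A) powr (1 + s)"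
  define n where "n = real (card A)"
  define K where "K = n powr s"
  have s0: "0 < s" using r s by simp
  have n: "4 powr (1 / s) \<le> n" using N NA unfolding n_def by linarith
  have "4 powr 0 \<le> 4 powr (1 / s)" using s0 by (intro powr_mono) auto
  then have n1: "1 \<le> n" using n by simp
  have "(4 powr (1 / s)) powr s \<le> K" unfolding K_def using n s0 by (intro powr_mono2) auto
  then have K4: "4 \<le> K" using s0 by (simp add: powr_powr)
  have Kpow: "K ^ k = n powr (real k * s)" for k
    using n1 unfolding K_def by (simp add: powr_powr mult.commute flip: powr_realpow)
  have Kn: "n powr (1 + s) = K * n" using n1 by (simp add: K_def powr_add)
  have "K ^ 171 \<le> n powr 1" unfolding Kpow using n1 r s by (intro powr_mono) auto
  then have "K ^ 171 \<le> real (card A)" using n1 by (simp add: n_def)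
  moreover have "real (card (A <#> A)) \<le> K * real (card A)" "real (card (A <+> A)) \<le> K * real (card A)"
    using small unfolding Kn[unfolded n_def] by simp_all
  ultimately obtain B E where BE: "B \<subseteq> A" "E = quot_set R (diff_set R B B) (diff_set R B B)" "subfield E R"
    "finite E" "n \<le> K ^ 2 * real (card B)" "card B \<le> card E" "real (card E) \<le> K ^ 39 * n"
    using exists_subfield_of_small_sum_product[OF A K4] unfolding n_def by blast
  have "n powr (1 - r) * K ^ 2 \<le> n powr 1"
    unfolding Kpow powr_add[symmetric] using n1 r s by (intro powr_mono) auto
  also have "\<dots> \<le> real (card B) * K ^ 2" using BE(5) n1 by (simp add: mult.commute)
  finally have cardB: "n powr (1 - r) \<le> real (card B)" using K4 by simp
  have "K ^ 39 * n = n powr (real 39 * s + 1)" unfolding Kpow powr_add using n1 by simp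
  also have "\<dots> \<le> n powr (1 + r)" using n1 r s by (intro powr_mono) auto
  finally have "real (card E) \<le> n powr (1 + r)" using BE(7) by linarith
  moreover have "n powr (1 - r) \<le> real (card E)" using cardB BE(6) by linarith
  ultimately show "\<exists>E A'. subfield E R \<and> finite E \<and> real (card A) powr (1 - r) \<le> real (card E) \<and>
      real (card E) \<le> real (card A) powr (1 + r) \<and> A' \<subseteq> A \<and>
      real (card A) powr (1 - r) \<le> real (card A') \<and>
      E = quot_set R (diff_set R A' A') (diff_set R A' A')"
    using BE cardB unfolding n_def by blast
qed

end

section \<open>Transfer to countable fields\<close>

text \<open>Names for the elements of a generated field: one constructor for each rule of
  \<open>generate_field\<close>, with generators indexed by natural numbers so that the type is
  countable.\<close>

datatype field_term = One | Gen nat | AInv field_term | MInv field_term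
  | Add field_term field_term | Mult field_term field_term

instance field_term :: countable
  by countable_datatype

primrec eval_field_term :: "('a, 'm) ring_scheme \<Rightarrow> (nat \<Rightarrow> 'a) \<Rightarrow> field_term \<Rightarrow> 'a" where
  "eval_field_term F g One = \<one>\<^bsub>F\<^esub>"
| "eval_field_term F g (Gen n) = g n"
| "eval_field_term F g (AInv t) = \<ominus>\<^bsub>F\<^esub> eval_field_term F g t"
| "eval_field_term F g (MInv t) = inv\<^bsub>F\<^esub> eval_field_term F g t"
| "eval_field_term F g (Add t u) = eval_field_term F g t \<oplus>\<^bsub>F\<^esub> eval_field_term F g u"
| "eval_field_term F g (Mult t u) = eval_field_term F g t \<otimes>\<^bsub>F\<^esub> eval_field_term F g u"

text \<open>Every element of the generated field is the value of a term.\<close>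

lemma countable_generate_field:
  fixes F :: "('a, 'm) ring_scheme"
  assumes "countable H"
  shows "countable (generate_field F H)"
proof -
  obtain f :: "'a \<Rightarrow> nat" where f: "inj_on f H" using assms by (auto simp: countable_def)
  \<comment> \<open>Outside the image of \<open>f\<close> the values of \<open>g\<close> are
    arbitrary. This is harmless, as the range of \<open>?eval\<close> only has to contain the
    generated field.\<close>
  define g where "g = inv_into H f"
  let ?eval = "eval_field_term F g"
  have "x \<in> range ?eval" if "x \<in> generate_field F H" for x
    using that
  proof (induction rule: generate_field.induct)
    case one
    show ?case using rangeI[of ?eval One] by simp
  next
    case (incl h)
    then show ?case using f rangeI[of ?eval "Gen (f h)"] by (simp add: g_def)
  next
    case (a_inv h)
    then obtain t where "h = ?eval t" by blast
    then show ?case using rangeI[of ?eval "AInv t"] by simp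
  next
    case (m_inv h)
    then obtain t where "h = ?eval t" by blast
    then show ?case using rangeI[of ?eval "MInv t"] by simp
  next
    case (eng_add h1 h2)
    then obtain t u where "h1 = ?eval t" "h2 = ?eval u" by blast
    then show ?case using rangeI[of ?eval "Add t u"] by simp
  next
    case (eng_mult h1 h2)
    then obtain t u where "h1 = ?eval t" "h2 = ?eval u" by blast
    then show ?case using rangeI[of ?eval "Mult t u"] by simp
  qed
  then show ?thesis
    by (intro countable_subset[OF subsetI countable_image[OF countableI_type]])
qed

lemma diff_set_eq_UN: "diff_set F A B = (\<Union>x\<in>A. \<Union>y\<in>B. {x \<ominus>\<^bsub>F\<^esub> y})"
  unfolding diff_set_def by blast

context ring_hom_ring
begin

section \<open>Images of sum, product, difference and quotient sets under ring homomorphisms\<close>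

lemma image_set_add:
  assumes "Y \<subseteq> carrier R" "Z \<subseteq> carrier R"
  shows "h ` (Y <+>\<^bsub>R\<^esub> Z) = h ` Y <+>\<^bsub>S\<^esub> h ` Z"
proof -
  have "h (y \<oplus>\<^bsub>R\<^esub> z) = h y \<oplus>\<^bsub>S\<^esub> h z" if "y \<in> Y" "z \<in> Z" for y z
    using that assms by (simp add: subset_iff)
  then show ?thesis unfolding set_add_def' by (simp add: image_UN)
qed

lemma image_set_mult:
  assumes "Y \<subseteq> carrier R" "Z \<subseteq> carrier R"
  shows "h ` (Y <#>\<^bsub>R\<^esub> Z) = h ` Y <#>\<^bsub>S\<^esub> h ` Z"
proof -
  have "h (y \<otimes>\<^bsub>R\<^esub> z) = h y \<otimes>\<^bsub>S\<^esub> h z" if "y \<in> Y" "z \<in> Z" for y z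
    using that assms by (simp add: subset_iff)
  then show ?thesis unfolding set_mult_def by (simp add: image_UN)
qed

lemma image_diff_set:
  assumes "Y \<subseteq> carrier R" "Z \<subseteq> carrier R"
  shows "h ` diff_set R Y Z = diff_set S (h ` Y) (h ` Z)"
proof -
  have "h (y \<ominus>\<^bsub>R\<^esub> z) = h y \<ominus>\<^bsub>S\<^esub> h z" if "y \<in> Y" "z \<in> Z" for y z
    using that assms by (simp add: R.minus_eq S.minus_eq subset_iff)
  then show ?thesis unfolding diff_set_eq_UN by (simp add: image_UN)
qed

text \<open>Injectivity makes denominators vanish in \<open>S\<close> exactly when they vanish in
  \<open>R\<close>; inverses are preserved because \<open>h\<close> maps \<open>z\<close> times its
  inverse to one.\<close>

lemma image_quot_set:
  assumes "field R" "field S" "inj_on h (carrier R)" "Y \<subseteq> carrier R" "Z \<subseteq> carrier R"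
  shows "h ` quot_set R Y Z = quot_set S (h ` Y) (h ` Z)"
proof -
  interpret R: field R by fact
  interpret S: field S by fact
  have zero: "h z = \<zero>\<^bsub>S\<^esub> \<longleftrightarrow> z = \<zero>\<^bsub>R\<^esub>" if "z \<in> Z" for z
    using that assms by (metis R.zero_closed hom_zero inj_on_eq_iff subsetD)
  have *: "h (y \<otimes>\<^bsub>R\<^esub> inv\<^bsub>R\<^esub> z) = h y \<otimes>\<^bsub>S\<^esub> inv\<^bsub>S\<^esub> h z"
    if "y \<in> Y" "z \<in> Z" "z \<noteq> \<zero>\<^bsub>R\<^esub>" for y z
  proof -
    have c: "y \<in> carrier R" "z \<in> carrier R" using that assms by auto
    then have zi: "inv\<^bsub>R\<^esub> z \<in> carrier R" "z \<otimes>\<^bsub>R\<^esub> inv\<^bsub>R\<^esub> z = \<one>\<^bsub>R\<^esub>"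
      using that by (simp_all add: R.field_Units)
    then have "h z \<otimes>\<^bsub>S\<^esub> h (inv\<^bsub>R\<^esub> z) = \<one>\<^bsub>S\<^esub>" using c by (metis hom_mult hom_one)
    then have "inv\<^bsub>S\<^esub> h z = h (inv\<^bsub>R\<^esub> z)" using c zi by (intro S.comm_inv_char) auto
    then show ?thesis using c zi by simp
  qed
  have "h ` quot_set R Y Z = {h (y \<otimes>\<^bsub>R\<^esub> inv\<^bsub>R\<^esub> z) | y z. y \<in> Y \<and> z \<in> Z - {\<zero>\<^bsub>R\<^esub>}}"
    unfolding quot_set_def by blast
  also have "\<dots> = {h y \<otimes>\<^bsub>S\<^esub> inv\<^bsub>S\<^esub> h z | y z. y \<in> Y \<and> z \<in> Z - {\<zero>\<^bsub>R\<^esub>}}"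
    using * by (metis (no_types, lifting) DiffE singletonI)
  also have "\<dots> = quot_set S (h ` Y) (h ` Z)"
    unfolding quot_set_def using zero by blast
  finally show ?thesis .
qed

end

text \<open>Pull \<open>A\<close> back to \<open>C\<close> along \<open>h\<close>, apply the
  property in \<open>S\<close>, and push the subfield and the subset forward. Injectivity preserves
  every cardinality involved.\<close>

lemma sum_product_subfield_transfer:
  assumes "field S" "field F" "h \<in> ring_hom S F" "inj_on h (carrier S)"
    and sps: "sum_product_subfield S r s N"
    and A: "A \<subseteq> h ` carrier S" "finite A" "N \<le> card A"
      "real (max (card (A <+>\<^bsub>F\<^esub> A)) (card (A <#>\<^bsub>F\<^esub> A))) \<le> real (card A) powr (1 + s)"
  shows "\<exists>E A'. subfield E F \<and> finite E \<and> real (card A) powr (1 - r) \<le> real (card E) \<and>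
      real (card E) \<le> real (card A) powr (1 + r) \<and> A' \<subseteq> A \<and>
      real (card A) powr (1 - r) \<le> real (card A') \<and>
      E = quot_set F (diff_set F A' A') (diff_set F A' A')"
proof -
  interpret S: field S by fact
  interpret F: field F by fact
  interpret h: ring_hom_ring S F h
    using S.ring_axioms F.ring_axioms assms(3) by (rule ring_hom_ringI2)
  have card_h: "card (h ` Y) = card Y" if "Y \<subseteq> carrier S" for Y
    using assms(4) that by (meson card_image inj_on_subset)
  define C where "C = {x \<in> carrier S. h x \<in> A}"
  have C: "C \<subseteq> carrier S" "h ` C = A" using A(1) by (auto simp: C_def)
  then have "finite C" using A(2) assms(4) by (metis finite_imageD inj_on_subset)
  have cC: "card C = card A" using card_h[OF C(1)] C by simp
  have "card (C <+>\<^bsub>S\<^esub> C) = card (A <+>\<^bsub>F\<^esub> A)" "card (C <#>\<^bsub>S\<^esub> C) = card (A <#>\<^bsub>F\<^esub> A)"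
    using C h.image_set_add[OF C(1) C(1)] h.image_set_mult[OF C(1) C(1)]
      card_h[of "C <+>\<^bsub>S\<^esub> C"] card_h[of "C <#>\<^bsub>S\<^esub> C"]
    by (simp_all add: S.set_add_closed S.set_mult_closed)
  then obtain E C' where E: "subfield E S" "finite E" "real (card A) powr (1 - r) \<le> real (card E)"
    "real (card E) \<le> real (card A) powr (1 + r)" "C' \<subseteq> C"
    "real (card A) powr (1 - r) \<le> real (card C')"
    "E = quot_set S (diff_set S C' C') (diff_set S C' C')"
    using sps[unfolded sum_product_subfield_def, rule_format, of C] C \<open>finite C\<close> cC A(3,4) by auto
  have c: "C' \<subseteq> carrier S" "E \<subseteq> carrier S"
    using E C subringE(1)[OF subfieldE(1)[OF E(1)]] by auto
  show ?thesis
  proof (intro exI conjI)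
    show "subfield (h ` E) F" using h.img_is_subfield(2)[OF E(1)] F.one_not_zero by simp
    show "finite (h ` E)" using E(2) by simp
    show "h ` C' \<subseteq> A" using E(5) C by auto
    show "h ` E = quot_set F (diff_set F (h ` C') (h ` C')) (diff_set F (h ` C') (h ` C'))"
      unfolding E(7) using c assms(1,2,4)
      by (simp add: h.image_quot_set h.image_diff_set S.diff_set_closed)
  qed (use E card_h[OF c(1)] card_h[OF c(2)] in simp_all)
qed

text \<open>The subfield generated by \<open>A\<close> is countable, so an injection
  \<open>f\<close> renames its elements to natural numbers; \<open>h\<close> undoes the
  renaming.\<close>

lemma (in field) exists_nat_field_embedding:
  assumes "A \<subseteq> carrier R" "countable A"
  obtains S :: "nat ring" and h where "field S" "h \<in> ring_hom S R" "inj_on h (carrier S)"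
    "A \<subseteq> h ` carrier S"
proof -
  define Q where "Q = generate_field R A"
  define R' where "R' = R\<lparr>carrier := Q\<rparr>"
  have Q: "A \<subseteq> Q" "Q \<subseteq> carrier R" "countable Q"
    unfolding Q_def using assms
    by (auto intro: generate_field.incl generate_field_in_carrier countable_generate_field)
  obtain f :: "'a \<Rightarrow> nat" where f: "inj_on f Q" using Q(3) by (auto simp: countable_def)
  interpret R': field R' unfolding R'_def Q_def using assms(1) by (rule generate_field_is_field)
  have inj: "inj_on f (carrier R')" using f by (simp add: R'_def)
  define h where "h = inv_into (carrier R') f"
  have h: "h \<in> ring_iso (image_ring f R') R'"
    unfolding h_def by (intro ring_iso_set_sym R'.ring_axioms inj_imp_image_ring_iso inj)
  then have bij: "bij_betw h (carrier (image_ring f R')) Q"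
    by (simp add: ring_iso_def R'_def)
  show ?thesis
  proof
    show "field (image_ring f R')" using inj by (rule R'.inj_imp_image_ring_is_field)
    show "h \<in> ring_hom (image_ring f R') R"
      using h Q(2) by (auto simp: ring_iso_def ring_hom_def R'_def Pi_iff subset_iff)
    show "inj_on h (carrier (image_ring f R'))" using bij by (simp add: bij_betw_def)
    show "A \<subseteq> h ` carrier (image_ring f R')" using bij Q(1) by (simp add: bij_betw_def)
  qed
qed

theorem corollary6p6p1:
  fixes r :: real
  assumes "0 < r" and "r < 1"
  shows "(\<exists>s N. 0 < s \<and> s < 1 \<and>
            (\<forall>F :: nat ring. field F \<longrightarrow> sum_product_subfield F r s N)) \<and>
         (\<forall>s N. 0 < s \<and> s < 1 \<and>
            (\<forall>F :: nat ring. field F \<longrightarrow> sum_product_subfield F r s N) \<longrightarrow>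
            (\<forall>F :: 'a ring. field F \<longrightarrow> sum_product_subfield F r s N))"
proof (intro conjI allI impI)
  \<comment> \<open>The explicit bounds on \<open>s\<close> and \<open>N\<close> do not mention the
    field, so one pair serves all of them.\<close>
  define s where "s = r / 200"
  obtain N :: nat where "4 powr (1 / s) \<le> real N" using real_arch_simple by blast
  then have "\<forall>F :: nat ring. field F \<longrightarrow> sum_product_subfield F r s N"
    using field.sum_product_subfield_explicit[OF _ assms s_def] by blast
  moreover have "0 < s" "s < 1" using assms by (simp_all add: s_def)
  ultimately show "\<exists>s N. 0 < s \<and> s < 1 \<and>
      (\<forall>F :: nat ring. field F \<longrightarrow> sum_product_subfield F r s N)"
    by blast
next
  fix s :: real and N :: nat and F :: "'a ring"
  assume nat: "0 < s \<and> s < 1 \<and> (\<forall>F :: nat ring. field F \<longrightarrow> sum_product_subfield F r s N)"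
    and F: "field F"
  show "sum_product_subfield F r s N"
    unfolding sum_product_subfield_def
  proof (intro allI impI)
    fix A assume A: "A \<subseteq> carrier F" "finite A" "N \<le> card A"
      "real (max (card (A <+>\<^bsub>F\<^esub> A)) (card (A <#>\<^bsub>F\<^esub> A))) \<le> real (card A) powr (1 + s)"
    \<comment> \<open>The field \<open>S\<close> may depend on \<open>A\<close>: the assumption
      provides the same \<open>s\<close> and \<open>N\<close> for every field with carrier in
      \<open>nat\<close>.\<close>
    obtain S :: "nat ring" and h where "field S" "h \<in> ring_hom S F" "inj_on h (carrier S)"
      "A \<subseteq> h ` carrier S"
      using field.exists_nat_field_embedding[OF F A(1) countable_finite[OF A(2)]] by blast
    with nat F A(2-4) show "\<exists>E A'. subfield E F \<and> finite E \<and>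
        real (card A) powr (1 - r) \<le> real (card E) \<and>
        real (card E) \<le> real (card A) powr (1 + r) \<and> A' \<subseteq> A \<and>
        real (card A) powr (1 - r) \<le> real (card A') \<and>
        E = quot_set F (diff_set F A' A') (diff_set F A' A')"
      by (intro sum_product_subfield_transfer[of S F h]) blast+
  qed
qed

end
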